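(* Let $p,q\in[1,\infty]$, let $\psi$ and $p$ satisfy the integrability condition (I) given in the context, and let $\boldsymbol\gamma=(\gamma_{\mathfrak u})_{\mathfrak u\subseteq[1:d]}$ be a family of non-negative weights, not all zero, such that $\gamma_{\mathfrak w}>0$ implies $\gamma_{\mathfrak u}>0$ for all $\mathfrak u\subseteq\mathfrak w$. Then $$\|\imath_{p,q,\psi,\boldsymbol\gamma}\|=\|\imath_{p,q,\psi,\boldsymbol\gamma}^{-1}\|=\|\jmath_{p,q,\psi,\boldsymbol\gamma}\|=\|\jmath_{p,q,\psi,\boldsymbol\gamma}^{-1}\|.$$
   Context: Setting. $D$ is an interval, either $D=[0,T)$ with $T\in(0,\infty]$ or $D=[0,T]$ with $T\in(0,\infty)$; $\psi:D\to[0,\infty)$ is a probability density function (with respect to Lebesgue measure) that is positive almost everywhere. $d$ is a positive integer, $[1:d]=\{1,\dots,d\}$, and $\mathfrak u,\mathfrak w$ denote subsets of $[1:d]$. For $\mathfrak u\neq\emptyset$, $D^{\mathfrak u}$ is the set of points $\boldsymbol x_{\mathfrak u}=(x_j)_{j\in\mathfrak u}$ with $x_j\in D$; functions on $D^{\mathfrak u}$ are identified with functions on $D^d$ depending only on the variables with indices in $\mathfrak u$. For $1\le p\le\infty$, $p'$ is the conjugate index, $1/p+1/p'=1$. $L_{p,\psi}(D^{\mathfrak u})$ is the Banach space of (classes of) real-valued functions with norm $\|g\|_{L_{p,\psi}(D^{\mathfrak u})}=\left(\int_{D^{\mathfrak u}}|g(\boldsymbol t_{\mathfrak u})|^p\prod_{j\in\mathfrak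 u}\psi(t_j)\,d\boldsymbol t_{\mathfrak u}\right)^{1/p}$ for $p<\infty$ and the essential supremum norm for $p=\infty$. $L_p^{\mathrm{loc}}(D)$ is the set of functions on $D$ whose restriction to $[0,x)$ is in $L_p([0,x))$ for all $x\in D$. Put $\overline\psi(t)=\int_t^T\psi(y)\,dy$. Integrability condition (I) for $p$ and $\psi$: either $p=\infty$ and $\overline\psi\in L_1(D)$; or $p<\infty$, $\psi^{-1/p}\in L_{p'}^{\mathrm{loc}}(D)$ and $\overline\psi\cdot\psi^{-1/p}\in L_{p'}(D)$. Kernels: $K_\pitchfork(x,t)=1_{[0,x)}(t)$, $K_A(x,t)=1_{[0,x)}(t)-\overline\psi(t)$ for $x,t\in D$, and $K_{\star,\mathfrak u}(\boldsymbol x_{\mathfrak u},\boldsymbol t_{\mathfrak u})=\prod_{j\in\mathfrak u}K_\star(x_j,t_j)$ for $\star\in\{\pitchfork,A\}$. For $\mathfrak u\ne\emptyset$ and $g_{\mathfrak u}\in L_{p,\psi}(D^{\mathfrak u})$ put $T_{\star,\mathfrak u}(g_{\mathfrak u})=\int_{D^{\mathfrak u}}g_{\mathfrak u}(\boldsymbol t_{\mathfrak u})K_{\star,\mathfrak u}(\cdot_{\mathfrak u},\boldsymbol t_{\mathfrak u})\,d\boldsymbol t_{\mathfrak u}$. For $\mathfrak u=\emptyset$, $L_{p,\psi}(D^\emptyset)=\mathbb R$ with norm $|\cdot|$ and $T_{\star,\emptyset}(c)$ is the constant function $c$. Let $F_{\star,p,\psi,\mathfrak u}=T_{\star,\mathfrak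 u}(L_{p,\psi}(D^{\mathfrak u}))$; the maps $T_{\star,\mathfrak u}$ are one-to-one, and $\|T_{\star,\mathfrak u}(g)\|_{F_{\star,p,\psi,\mathfrak u}}:=\|g\|_{L_{p,\psi}(D^{\mathfrak u})}$. The sum of the spaces $F_{\star,p,\psi,\mathfrak u}$ over $\mathfrak u\subseteq[1:d]$ (inside the continuous functions on $D^d$) is direct. For weights $\boldsymbol\gamma$ let $\mathfrak U_{\boldsymbol\gamma}=\{\mathfrak u\subseteq[1:d]:\gamma_{\mathfrak u}>0\}$, assumed non-empty. For $\star\in\{\pitchfork,A\}$, $W_{\star,p,q,\psi,\boldsymbol\gamma}=\bigoplus_{\mathfrak u\in\mathfrak U_{\boldsymbol\gamma}}F_{\star,p,\psi,\mathfrak u}$, a space of functions $f=\sum_{\mathfrak u\in\mathfrak U_{\boldsymbol\gamma}}T_{\star,\mathfrak u}(g_{\star,\mathfrak u})$ on $D^d$, with norm $\|f\|_{W_{\star,p,q,\psi,\boldsymbol\gamma}}=\left(\sum_{\mathfrak u\in\mathfrak U_{\boldsymbol\gamma}}(\|g_{\star,\mathfrak u}\|_{L_{p,\psi}(D^{\mathfrak u})}/\gamma_{\mathfrak u})^q\right)^{1/q}$ for $q<\infty$ and the maximum over $\mathfrak u\in\mathfrak U_{\boldsymbol\gamma}$ for $q=\infty$. ($\star=\pitchfork$: anchored space; $\star=A$: ANOVA space.) Under the assumption on $\boldsymbol\gamma$ in the claim the two spaces coincide as vector spaces of functions; $\imath_{p,q,\psi,\boldsymbol\gamma}:W_{A,p,q,\psi,\boldsymbol\gamma}\to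 W_{\pitchfork,p,q,\psi,\boldsymbol\gamma}$ is the identity map (embedding), which is continuous together with its inverse. Let $\ell_{q,\boldsymbol\gamma}((L_{p,\psi}(D^{\mathfrak u}))_{\mathfrak u})=\bigoplus_{\mathfrak u\in\mathfrak U_{\boldsymbol\gamma}}L_{p,\psi}(D^{\mathfrak u})$ with norm $\left(\sum_{\mathfrak u\in\mathfrak U_{\boldsymbol\gamma}}(\|g_{\mathfrak u}\|_{L_{p,\psi}(D^{\mathfrak u})}/\gamma_{\mathfrak u})^q\right)^{1/q}$ (maximum if $q=\infty$). The map $T_\star((g_{\mathfrak u})_{\mathfrak u})=\sum_{\mathfrak u\in\mathfrak U_{\boldsymbol\gamma}}T_{\star,\mathfrak u}(g_{\mathfrak u})$ is an isometric isomorphism from this space onto $W_{\star,p,q,\psi,\boldsymbol\gamma}$. Define the operator $\jmath_{p,q,\psi,\boldsymbol\gamma}=T_\pitchfork^{-1}\circ\imath_{p,q,\psi,\boldsymbol\gamma}\circ T_A$ on $\ell_{q,\boldsymbol\gamma}((L_{p,\psi}(D^{\mathfrak u}))_{\mathfrak u})$. All norms of $\imath,\imath^{-1},\jmath,\jmath^{-1}$ are operator norms. *)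

theory Defs
  imports "HOL-Probability.Probability"
begin

section \<open>Lebesgue spaces of equivalence classes\<close>

definition conjugate_index :: "ennreal \<Rightarrow> ennreal" where
  "conjugate_index p = inverse (1 - inverse p)"

lemma conjugate_index: "1 \<le> p \<Longrightarrow> 1 / p + 1 / conjugate_index p = 1"
proof -
  assume p: "1 \<le> p"
  have invinv: "inverse (inverse x) = x" for x :: ennreal
  proof (cases x)
    case (real r)
    then show ?thesis
      by (cases "r = 0") (auto simp: inverse_ennreal)
  qed simp
  have "inverse p \<le> 1"
  proof (cases p)
    case (real r)
    with p have "1 \<le> r" by simp
    then show ?thesis
      using real by (simp add: inverse_ennreal inverse_le_1_iff)
  qed simp
  then show ?thesis
    by (simp add: conjugate_index_def divide_ennreal_def invinv add_diff_inverse_ennreal)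
qed

definition Lp_fun :: "'a measure \<Rightarrow> ennreal \<Rightarrow> ('a \<Rightarrow> real) set" where
  "Lp_fun M p = {g \<in> borel_measurable M.
     if p = \<infinity> then esssup M (\<lambda>t. ereal \<bar>g t\<bar>) < \<infinity>
     else integrable M (\<lambda>t. \<bar>g t\<bar> powr enn2real p)}"

definition Lp_norm :: "'a measure \<Rightarrow> ennreal \<Rightarrow> ('a \<Rightarrow> real) \<Rightarrow> real" where
  "Lp_norm M p g =
     (if p = \<infinity> then real_of_ereal (esssup M (\<lambda>t. ereal \<bar>g t\<bar>))
      else (\<integral>t. \<bar>g t\<bar> powr enn2real p \<partial>M) powr (1 / enn2real p))"

definition Lp_space :: "'a measure \<Rightarrow> ennreal \<Rightarrow> ('a \<Rightarrow> real) set set" where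
  "Lp_space M p =
     Lp_fun M p // {(g, h). g \<in> Lp_fun M p \<and> h \<in> Lp_fun M p \<and> (AE t in M. g t = h t)}"

definition rep :: "('a \<Rightarrow> real) set \<Rightarrow> 'a \<Rightarrow> real" where
  "rep c = (SOME g. g \<in> c)"

definition class_norm :: "'a measure \<Rightarrow> ennreal \<Rightarrow> ('a \<Rightarrow> real) set \<Rightarrow> real" where
  "class_norm M p c = Lp_norm M p (rep c)"

section \<open>Operator norms\<close>

text \<open>
  Operator norm of a linear map \<open>A\<close> on a normed space with carrier \<open>V\<close> and norm \<open>N\<close>, the norm
  of the target space being \<open>N'\<close>. The values lie in \<open>[0,\<infinity>]\<close> so that the supremum has its
  usual meaning without a boundedness proof.
\<close>

definition op_norm :: "'a set \<Rightarrow> ('a \<Rightarrow> real) \<Rightarrow> ('b \<Rightarrow> real) \<Rightarrow> ('a \<Rightarrow> 'b) \<Rightarrow> ennreal" where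
  "op_norm V N N' A = (SUP v \<in> {v \<in> V. N v \<le> 1}. ennreal (N' (A v)))"

section \<open>Weighted spaces over the domain\<close>

text \<open>
  A point of \<open>D\<^sup>u\<close>, for \<open>u\<close> a set of indices, is a function in \<open>PiE u (\<lambda>_. D)\<close>.
  For \<open>u = {}\<close> this is a one-point set and \<open>leb_prod D {}\<close> is the unit point mass, so that
  \<open>Lp_space (leb_psi D \<psi> {}) p\<close> is the real line with the absolute value as norm, and
  \<open>T_op K D {} g\<close> below is the constant function with that value.
\<close>

definition leb_prod :: "real set \<Rightarrow> nat set \<Rightarrow> (nat \<Rightarrow> real) measure" where
  "leb_prod D u = PiM u (\<lambda>_. restrict_space lborel D)"

definition leb_psi :: "real set \<Rightarrow> (real \<Rightarrow> real) \<Rightarrow> nat set \<Rightarrow> (nat \<Rightarrow> real) measure" where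
  "leb_psi D \<psi> u = density (leb_prod D u) (\<lambda>t. \<Prod>j\<in>u. ennreal (\<psi> (t j)))"

definition psi_bar :: "real set \<Rightarrow> (real \<Rightarrow> real) \<Rightarrow> real \<Rightarrow> real" where
  "psi_bar D \<psi> t = (LINT y : D \<inter> {t..} | lborel. \<psi> y)"

definition Lp_loc :: "real set \<Rightarrow> ennreal \<Rightarrow> (real \<Rightarrow> real) set" where
  "Lp_loc D p = {g. \<forall>x\<in>D. g \<in> Lp_fun (restrict_space lborel {0..<x}) p}"

definition integrability_condition :: "real set \<Rightarrow> (real \<Rightarrow> real) \<Rightarrow> ennreal \<Rightarrow> bool" where
  "integrability_condition D \<psi> p \<longleftrightarrow>
     p = \<infinity> \<and> psi_bar D \<psi> \<in> Lp_fun (restrict_space lborel D) 1 \<or>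
     p < \<infinity> \<and>
       (\<lambda>t. \<psi> t powr (- 1 / enn2real p)) \<in> Lp_loc D (conjugate_index p) \<and>
       (\<lambda>t. psi_bar D \<psi> t * \<psi> t powr (- 1 / enn2real p))
         \<in> Lp_fun (restrict_space lborel D) (conjugate_index p)"

definition K_anchored :: "real \<Rightarrow> real \<Rightarrow> real" where
  "K_anchored x t = indicator {0..<x} t"

definition K_anova :: "real set \<Rightarrow> (real \<Rightarrow> real) \<Rightarrow> real \<Rightarrow> real \<Rightarrow> real" where
  "K_anova D \<psi> x t = indicator {0..<x} t - psi_bar D \<psi> t"

definition T_op ::
  "(real \<Rightarrow> real \<Rightarrow> real) \<Rightarrow> real set \<Rightarrow> nat set \<Rightarrow> ((nat \<Rightarrow> real) \<Rightarrow> real) set \<Rightarrow> (nat \<Rightarrow> real) \<Rightarrow> real"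
  where "T_op K D u c x = (\<integral>t. rep c t * (\<Prod>j\<in>u. K (x j) (t j)) \<partial>leb_prod D u)"

definition active :: "nat \<Rightarrow> (nat set \<Rightarrow> real) \<Rightarrow> nat set set" where
  "active d \<gamma> = {u. u \<subseteq> {1..d} \<and> \<gamma> u > 0}"

type_synonym family = "nat set \<Rightarrow> ((nat \<Rightarrow> real) \<Rightarrow> real) set"

definition ell ::
  "real set \<Rightarrow> (real \<Rightarrow> real) \<Rightarrow> nat \<Rightarrow> (nat set \<Rightarrow> real) \<Rightarrow> ennreal \<Rightarrow> family set" where
  "ell D \<psi> d \<gamma> p = PiE (active d \<gamma>) (\<lambda>u. Lp_space (leb_psi D \<psi> u) p)"

definition ell_norm ::
  "real set \<Rightarrow> (real \<Rightarrow> real) \<Rightarrow> nat \<Rightarrow> (nat set \<Rightarrow> real) \<Rightarrow> ennreal \<Rightarrow> ennreal \<Rightarrow> family \<Rightarrow> real" where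
  "ell_norm D \<psi> d \<gamma> p q G =
     (if q = \<infinity> then (MAX u\<in>active d \<gamma>. class_norm (leb_psi D \<psi> u) p (G u) / \<gamma> u)
      else (\<Sum>u\<in>active d \<gamma>. (class_norm (leb_psi D \<psi> u) p (G u) / \<gamma> u) powr enn2real q)
             powr (1 / enn2real q))"

definition T_sum ::
  "(real \<Rightarrow> real \<Rightarrow> real) \<Rightarrow> real set \<Rightarrow> nat \<Rightarrow> (nat set \<Rightarrow> real) \<Rightarrow> family \<Rightarrow> (nat \<Rightarrow> real) \<Rightarrow> real" where
  "T_sum K D d \<gamma> G = restrict (\<lambda>x. \<Sum>u\<in>active d \<gamma>. T_op K D u (G u) x) (PiE {1..d} (\<lambda>_. D))"

definition W_space ::
  "(real \<Rightarrow> real \<Rightarrow> real) \<Rightarrow> real set \<Rightarrow> (real \<Rightarrow> real) \<Rightarrow> nat \<Rightarrow> (nat set \<Rightarrow> real) \<Rightarrow> ennreal \<Rightarrow>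
     ((nat \<Rightarrow> real) \<Rightarrow> real) set" where
  "W_space K D \<psi> d \<gamma> p = T_sum K D d \<gamma> ` ell D \<psi> d \<gamma> p"

definition T_inv ::
  "(real \<Rightarrow> real \<Rightarrow> real) \<Rightarrow> real set \<Rightarrow> (real \<Rightarrow> real) \<Rightarrow> nat \<Rightarrow> (nat set \<Rightarrow> real) \<Rightarrow> ennreal \<Rightarrow>
     ((nat \<Rightarrow> real) \<Rightarrow> real) \<Rightarrow> family" where
  "T_inv K D \<psi> d \<gamma> p = inv_into (ell D \<psi> d \<gamma> p) (T_sum K D d \<gamma>)"

definition W_norm ::
  "(real \<Rightarrow> real \<Rightarrow> real) \<Rightarrow> real set \<Rightarrow> (real \<Rightarrow> real) \<Rightarrow> nat \<Rightarrow> (nat set \<Rightarrow> real) \<Rightarrow> ennreal \<Rightarrow> ennreal \<Rightarrow>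
     ((nat \<Rightarrow> real) \<Rightarrow> real) \<Rightarrow> real" where
  "W_norm K D \<psi> d \<gamma> p q f = ell_norm D \<psi> d \<gamma> p q (T_inv K D \<psi> d \<gamma> p f)"

text \<open>
  The embedding of the ANOVA space into the anchored space and its counterpart between the
  sequence spaces. As maps, these do not depend on \<open>q\<close>; only the norms do.
\<close>

definition emb_i ::
  "real set \<Rightarrow> (real \<Rightarrow> real) \<Rightarrow> nat \<Rightarrow> (nat set \<Rightarrow> real) \<Rightarrow> ennreal \<Rightarrow>
     ((nat \<Rightarrow> real) \<Rightarrow> real) \<Rightarrow> ((nat \<Rightarrow> real) \<Rightarrow> real)" where
  "emb_i D \<psi> d \<gamma> p = restrict (\<lambda>f. f) (W_space (K_anova D \<psi>) D \<psi> d \<gamma> p)"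

definition op_j ::
  "real set \<Rightarrow> (real \<Rightarrow> real) \<Rightarrow> nat \<Rightarrow> (nat set \<Rightarrow> real) \<Rightarrow> ennreal \<Rightarrow> family \<Rightarrow> family" where
  "op_j D \<psi> d \<gamma> p =
     restrict (T_inv K_anchored D \<psi> d \<gamma> p \<circ> emb_i D \<psi> d \<gamma> p \<circ> T_sum (K_anova D \<psi>) D d \<gamma>)
       (ell D \<psi> d \<gamma> p)"

end

theory Submission
  imports Defs
begin

text \<open>
  On representatives, expanding the product over \<open>j \<in> w\<close> of
  \<open>K_anova = K_anchored - psi_bar\<close> and integrating out the variables that carry a factor
  \<open>psi_bar\<close> shows that the operator \<open>j\<close> maps a family \<open>g\<close> to
  \<open>u \<mapsto> \<Sum>w \<supseteq> u. (-1)\<^bsup>|w - u|\<^esup> \<integral> g w * \<Prod> psi_bar\<close>, and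
  \<open>K_anchored = K_anova + psi_bar\<close> gives for its inverse the same formula without the signs.
  Hence the inverse of \<open>j\<close> is the conjugate of \<open>j\<close> by the isometric involution
  \<open>g u \<mapsto> (-1)\<^bsup>|u|\<^esup> g u\<close>, so both have the same norm; the embeddings are
  conjugate to them by isometries. Hoelder's inequality makes the integrals well defined, and
  injectivity of the anchored representation holds because boxes with a corner at the anchor
  generate the sigma-algebra.
\<close>

section \<open>Lebesgue spaces\<close>

text \<open>The inverses in the statement are choice functions (\<open>inv_into\<close>) and the
  spaces consist of classes, so before norms can be compared both representations must be injective
  and \<open>J\<close> must respect classes. Composing \<open>J (- 1)\<close> with
  \<open>J 1\<close> directly would give a double sum of iterated marginals. This is avoided: under
  the anchored representation the composition collapses to two changes of kernel, so injectivity of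
  that representation gives \<open>J (- 1)\<close> after \<open>J 1\<close> as the identity. The
  sign involution turns this into the other order, and injectivity of the ANOVA representation
  follows. The integrability condition enters only through \<open>admissible\<close>: each kernel
  divided by psi^(1/p) lies in the conjugate Lebesgue space, so multiplication by psi^(1/p) in every
  variable moves the estimates to unweighted product measures. The operator norms take values in
  [0, infinity]; their equality is one of suprema over the unit ball of the sequence space, which
  the involution maps onto itself, and is obtained without estimating any norm.\<close>

lemma Lp_fun_measurable: "g \<in> Lp_fun M p \<Longrightarrow> g \<in> borel_measurable M"
  by (simp add: Lp_fun_def)

lemma Lp_fun_top_iff:
  "g \<in> Lp_fun M \<top> \<longleftrightarrow> g \<in> borel_measurable M \<and> (\<exists>B\<ge>0. AE t in M. \<bar>g t\<bar> \<le> B)"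
proof (cases "g \<in> borel_measurable M")
  case True
  note [measurable] = True
  have "esssup M (\<lambda>t. ereal \<bar>g t\<bar>) < \<infinity> \<longleftrightarrow> (\<exists>B\<ge>0. AE t in M. \<bar>g t\<bar> \<le> B)"
  proof
    assume "esssup M (\<lambda>t. ereal \<bar>g t\<bar>) < \<infinity>"
    then obtain B where "esssup M (\<lambda>t. ereal \<bar>g t\<bar>) \<le> ereal B"
      by (metis less_ereal.simps(2) less_imp_le order_refl real_of_ereal.elims ereal_less_eq(2))
    \<comment> \<open>On a null space the essential supremum is -infinity and \<open>B\<close> may
      be negative, hence the maximum with 0.\<close>
    then have "AE t in M. \<bar>g t\<bar> \<le> max 0 B"
      using esssup_AE[of "\<lambda>t. ereal \<bar>g t\<bar>" M]
      by (auto elim!: eventually_mono dest: order_trans simp: le_max_iff_disj)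
    then show "\<exists>B\<ge>0. AE t in M. \<bar>g t\<bar> \<le> B"
      by (intro exI[of _ "max 0 B"]) simp
  next
    assume "\<exists>B\<ge>0. AE t in M. \<bar>g t\<bar> \<le> B"
    then obtain B where "AE t in M. \<bar>g t\<bar> \<le> B" by blast
    then have "esssup M (\<lambda>t. ereal \<bar>g t\<bar>) \<le> ereal B"
      by (intro esssup_I) auto
    also have "\<dots> < \<infinity>" by simp
    finally show "esssup M (\<lambda>t. ereal \<bar>g t\<bar>) < \<infinity>" .
  qed
  then show ?thesis by (simp add: Lp_fun_def True)
qed (simp add: Lp_fun_def)

lemma Lp_fun_finite_iff:
  "p \<noteq> \<top> \<Longrightarrow> g \<in> Lp_fun M p \<longleftrightarrow>
     g \<in> borel_measurable M \<and> integrable M (\<lambda>t. \<bar>g t\<bar> powr enn2real p)"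
  by (simp add: Lp_fun_def)

lemma Lp_fun_AE_cong:
  assumes "g \<in> Lp_fun M p" "h \<in> borel_measurable M" "AE t in M. g t = h t"
  shows "h \<in> Lp_fun M p"
proof (cases "p = \<top>")
  case True
  with assms obtain B where "B \<ge> 0" "AE t in M. \<bar>g t\<bar> \<le> B"
    unfolding True Lp_fun_top_iff by auto
  moreover from this(2) assms(3) have "AE t in M. \<bar>h t\<bar> \<le> B"
    by eventually_elim simp
  ultimately show ?thesis
    unfolding True Lp_fun_top_iff using assms(2) by auto
next
  case False
  have [measurable]: "g \<in> borel_measurable M" "h \<in> borel_measurable M"
    using assms by (auto simp: Lp_fun_def)
  have "integrable M (\<lambda>t. \<bar>g t\<bar> powr enn2real p) \<longleftrightarrow> integrable M (\<lambda>t. \<bar>h t\<bar> powr enn2real p)"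
    using assms(3) by (intro integrable_cong_AE) auto
  with assms False show ?thesis by (simp add: Lp_fun_finite_iff)
qed

lemma Lp_norm_AE_cong:
  assumes [measurable]: "g \<in> borel_measurable M" "h \<in> borel_measurable M"
    and "AE t in M. \<bar>g t\<bar> = \<bar>h t\<bar>"
  shows "Lp_norm M p g = Lp_norm M p h"
proof -
  have "esssup M (\<lambda>t. ereal \<bar>g t\<bar>) = esssup M (\<lambda>t. ereal \<bar>h t\<bar>)"
    using assms(3) by (intro esssup_AE_cong) auto
  moreover have "(\<integral>t. \<bar>g t\<bar> powr enn2real p \<partial>M) = (\<integral>t. \<bar>h t\<bar> powr enn2real p \<partial>M)"
    using assms(3) by (intro integral_cong_AE) auto
  ultimately show ?thesis by (simp add: Lp_norm_def)
qed

lemma Lp_fun_cmult: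
  assumes "g \<in> Lp_fun M p"
  shows "(\<lambda>t. c * g t) \<in> Lp_fun M p"
proof (cases "p = \<top>")
  case True
  from assms obtain B where "B \<ge> 0" "AE t in M. \<bar>g t\<bar> \<le> B" and m: "g \<in> borel_measurable M"
    unfolding True Lp_fun_top_iff by auto
  then have "AE t in M. \<bar>c * g t\<bar> \<le> \<bar>c\<bar> * B"
    by (auto simp: abs_mult intro!: mult_left_mono elim!: eventually_mono)
  with \<open>B \<ge> 0\<close> m show ?thesis
    unfolding True Lp_fun_top_iff by (auto intro!: exI[of _ "\<bar>c\<bar> * B"])
next
  case False
  with assms show ?thesis
    by (auto simp: Lp_fun_finite_iff abs_mult powr_mult)
qed

text \<open>The crude constant comes from a + b <= 2 max(a, b). It suffices because
  \<open>Lp_fun_add\<close> asks for finiteness, not for a norm estimate.\<close>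

lemma powr_add_le:
  fixes a b r :: real
  assumes "0 \<le> a" "0 \<le> b" "0 \<le> r"
  shows "(a + b) powr r \<le> 2 powr r * (a powr r + b powr r)"
proof -
  have "(a + b) powr r \<le> (2 * max a b) powr r"
    using assms by (intro powr_mono2) auto
  also have "\<dots> = 2 powr r * (max a b) powr r"
    using assms by (simp add: powr_mult)
  also have "\<dots> \<le> 2 powr r * (a powr r + b powr r)"
    by (intro mult_left_mono) (auto simp: max_def)
  finally show ?thesis .
qed

lemma Lp_fun_add:
  assumes "g \<in> Lp_fun M p" "h \<in> Lp_fun M p"
  shows "(\<lambda>t. g t + h t) \<in> Lp_fun M p"
proof (cases "p = \<top>")
  case True
  from assms obtain A B where "A \<ge> 0" "AE t in M. \<bar>g t\<bar> \<le> A" "g \<in> borel_measurable M"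
    "B \<ge> 0" "AE t in M. \<bar>h t\<bar> \<le> B" "h \<in> borel_measurable M"
    unfolding True Lp_fun_top_iff by auto
  moreover from this have "AE t in M. \<bar>g t + h t\<bar> \<le> A + B"
    by (auto elim!: eventually_elim2)
  ultimately show ?thesis
    unfolding True Lp_fun_top_iff by (auto intro!: exI[of _ "A + B"])
next
  case False
  have [measurable]: "g \<in> borel_measurable M" "h \<in> borel_measurable M"
    using assms by (auto simp: Lp_fun_def)
  have "integrable M (\<lambda>t. \<bar>g t + h t\<bar> powr enn2real p)"
  proof (rule Bochner_Integration.integrable_bound)
    show "integrable M (\<lambda>t. 2 powr enn2real p * (\<bar>g t\<bar> powr enn2real p + \<bar>h t\<bar> powr enn2real p))"
      using assms False by (auto simp: Lp_fun_finite_iff)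
    have "\<bar>g t + h t\<bar> powr enn2real p
      \<le> 2 powr enn2real p * (\<bar>g t\<bar> powr enn2real p + \<bar>h t\<bar> powr enn2real p)" for t
      by (rule order_trans[OF powr_mono2 powr_add_le]) auto
    then show "AE t in M. norm (\<bar>g t + h t\<bar> powr enn2real p)
      \<le> norm (2 powr enn2real p * (\<bar>g t\<bar> powr enn2real p + \<bar>h t\<bar> powr enn2real p))"
      by auto
  qed measurable
  with False show ?thesis by (simp add: Lp_fun_finite_iff)
qed

lemma Lp_fun_diff:
  "g \<in> Lp_fun M p \<Longrightarrow> h \<in> Lp_fun M p \<Longrightarrow> (\<lambda>t. g t - h t) \<in> Lp_fun M p"
  using Lp_fun_add[OF _ Lp_fun_cmult[of h M p "-1"]] by simp

lemma Lp_fun_sum: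
  assumes "finite A" "\<And>i. i \<in> A \<Longrightarrow> g i \<in> Lp_fun M p"
  shows "(\<lambda>t. \<Sum>i\<in>A. g i t) \<in> Lp_fun M p"
  using assms
proof (induction A)
  case empty
  have "(\<lambda>t. 0) \<in> Lp_fun M p"
    by (cases "p = \<top>") (auto simp: Lp_fun_top_iff Lp_fun_finite_iff intro: exI[of _ 0])
  then show ?case by simp
next
  case (insert i A)
  then show ?case using Lp_fun_add[of "g i" M p] by simp
qed

section \<open>Conjugate indices and Hoelder's inequality\<close>

lemma conjugate_index_cases:
  assumes "1 \<le> p"
  obtains "p = \<top>" "conjugate_index p = 1"
  | "p = 1" "conjugate_index p = \<top>"
  | "p \<noteq> \<top>" "conjugate_index p \<noteq> \<top>" "1 < enn2real p" "1 < enn2real (conjugate_index p)"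
    "1 / enn2real p + 1 / enn2real (conjugate_index p) = 1"
proof (cases p)
  case top
  then show thesis by (auto simp: conjugate_index_def intro!: that(1))
next
  case (real r)
  with assms have r: "1 \<le> r" by simp
  show thesis
  proof (cases "r = 1")
    case True
    then show thesis using real by (auto simp: conjugate_index_def intro!: that(2))
  next
    case False
    with r have r1: "1 < r" by simp
    then have "conjugate_index p = ennreal (r / (r - 1))"
      using real
      by (simp add: conjugate_index_def inverse_ennreal ennreal_minus field_simps flip: ennreal_1)
    with r1 real show thesis
      by (intro that(3)) (auto simp: field_simps)
  qed
qed

text \<open>Young's inequality dominates the product pointwise by an integrable function. The
  additive bound on the integral becomes homogeneous after scaling \<open>f\<close>, which is done
  in \<open>Lp_fun_mult_integral_bound\<close>.\<close>

lemma Youngs_integrable: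
  assumes "1 < P" "1 < Q" "1 / P + 1 / Q = 1"
    and [measurable]: "f \<in> borel_measurable M" "b \<in> borel_measurable M"
    and f: "integrable M (\<lambda>t. \<bar>f t\<bar> powr P)" and b: "integrable M (\<lambda>t. \<bar>b t\<bar> powr Q)"
  shows "integrable M (\<lambda>t. f t * b t :: real)"
    and "\<bar>\<integral>t. f t * b t \<partial>M\<bar> \<le> (\<integral>t. \<bar>f t\<bar> powr P \<partial>M) / P + (\<integral>t. \<bar>b t\<bar> powr Q \<partial>M) / Q"
proof -
  let ?r = "\<lambda>t. \<bar>f t\<bar> powr P / P + \<bar>b t\<bar> powr Q / Q"
  have r: "integrable M ?r" using f b by auto
  have le: "norm (f t * b t) \<le> ?r t" for t
    using Youngs_inequality[of P Q "\<bar>f t\<bar>" "\<bar>b t\<bar>"] assms by (simp add: abs_mult)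
  show i: "integrable M (\<lambda>t. f t * b t)"
    by (rule Bochner_Integration.integrable_bound[OF r])
      (use le in \<open>auto intro!: AE_I2 intro: order_trans[OF _ abs_ge_self]\<close>)
  have "\<bar>\<integral>t. f t * b t \<partial>M\<bar> \<le> integral\<^sup>L M ?r"
    using order_trans[OF integral_abs_bound integral_mono[OF integrable_abs[OF i] r]] le by simp
  also have "\<dots> = (\<integral>t. \<bar>f t\<bar> powr P \<partial>M) / P + (\<integral>t. \<bar>b t\<bar> powr Q \<partial>M) / Q"
    using f b by simp
  finally show "\<bar>\<integral>t. f t * b t \<partial>M\<bar> \<le> (\<integral>t. \<bar>f t\<bar> powr P \<partial>M) / P + (\<integral>t. \<bar>b t\<bar> powr Q \<partial>M) / Q" .
qed

lemma integrable_mult_AE_bounded: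
  fixes f b :: "'a \<Rightarrow> real"
  assumes f: "integrable M f" and [measurable]: "b \<in> borel_measurable M"
    and B: "AE t in M. \<bar>b t\<bar> \<le> B"
  shows "integrable M (\<lambda>t. f t * b t)"
    and "\<bar>\<integral>t. f t * b t \<partial>M\<bar> \<le> B * (\<integral>t. \<bar>f t\<bar> \<partial>M)"
proof -
  have [measurable]: "f \<in> borel_measurable M" using f by simp
  have r: "integrable M (\<lambda>t. B * \<bar>f t\<bar>)" using f by auto
  have le: "AE t in M. norm (f t * b t) \<le> B * \<bar>f t\<bar>"
    using B by eventually_elim (simp add: abs_mult mult.commute mult_right_mono)
  show i: "integrable M (\<lambda>t. f t * b t)"
    by (rule Bochner_Integration.integrable_bound[OF r])
      (use le in \<open>auto elim!: eventually_mono intro: order_trans[OF _ abs_ge_self]\<close>)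
  show "\<bar>\<integral>t. f t * b t \<partial>M\<bar> \<le> B * (\<integral>t. \<bar>f t\<bar> \<partial>M)"
    using order_trans[OF integral_abs_bound integral_mono_AE[OF integrable_abs[OF i] r]] le by simp
qed

lemma Lp_fun_one_iff: "g \<in> Lp_fun M 1 \<longleftrightarrow> integrable M g"
  by (auto simp: Lp_fun_def simp: integrable_abs_iff dest: borel_measurable_integrable)

lemma Lp_fun_mult_integrable:
  assumes p: "1 \<le> p" and f: "f \<in> Lp_fun M p" and b: "b \<in> Lp_fun M (conjugate_index p)"
  shows "integrable M (\<lambda>t. f t * b t)"
proof (rule conjugate_index_cases[OF p])
  assume *: "p = \<top>" "conjugate_index p = 1"
  then obtain B where "AE t in M. \<bar>f t\<bar> \<le> B"
    using f by (auto simp: Lp_fun_top_iff)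
  moreover have "integrable M b" "f \<in> borel_measurable M"
    using * f b by (auto simp: Lp_fun_one_iff dest: Lp_fun_measurable)
  ultimately show ?thesis
    using integrable_mult_AE_bounded(1)[of M b f B] by (simp add: mult.commute)
next
  assume *: "p = 1" "conjugate_index p = \<top>"
  then obtain B where "AE t in M. \<bar>b t\<bar> \<le> B"
    using b by (auto simp: Lp_fun_top_iff)
  moreover have "integrable M f" "b \<in> borel_measurable M"
    using * f b by (auto simp: Lp_fun_one_iff dest: Lp_fun_measurable)
  ultimately show ?thesis
    by (intro integrable_mult_AE_bounded(1))
next
  assume "p \<noteq> \<top>" "conjugate_index p \<noteq> \<top>" "1 < enn2real p" "1 < enn2real (conjugate_index p)"
    "1 / enn2real p + 1 / enn2real (conjugate_index p) = 1"
  then show ?thesis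
    using f b by (intro Youngs_integrable(1)[where P = "enn2real p" and Q = "enn2real (conjugate_index p)"])
      (auto simp: Lp_fun_finite_iff)
qed

text \<open>Hoelder's inequality with p-th powers on both sides and one constant for all
  \<open>f\<close>: in this form it can be applied to each section of a function of two variables
  and then integrated over the other variable. The constant is not meant to be sharp.\<close>

lemma Lp_fun_mult_integral_bound:
  assumes p: "1 \<le> p" "p \<noteq> \<top>" and b: "b \<in> Lp_fun M (conjugate_index p)"
  obtains C where "C \<ge> 0" and "\<And>f. f \<in> Lp_fun M p \<Longrightarrow>
    \<bar>\<integral>t. f t * b t \<partial>M\<bar> powr enn2real p \<le> C * (\<integral>t. \<bar>f t\<bar> powr enn2real p \<partial>M)"
proof (rule conjugate_index_cases[OF p(1)])
  assume "p = \<top>" with p show thesis by simp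
next
  assume *: "p = 1" "conjugate_index p = \<top>"
  then obtain B where B: "B \<ge> 0" "AE t in M. \<bar>b t\<bar> \<le> B" and [measurable]: "b \<in> borel_measurable M"
    using b by (auto simp: Lp_fun_top_iff)
  show thesis
  proof (rule that[OF B(1)])
    fix f assume "f \<in> Lp_fun M p"
    then have "integrable M f" using * by (simp add: Lp_fun_one_iff)
    from integrable_mult_AE_bounded(2)[OF this _ B(2)] *
    show "\<bar>\<integral>t. f t * b t \<partial>M\<bar> powr enn2real p \<le> B * (\<integral>t. \<bar>f t\<bar> powr enn2real p \<partial>M)"
      by simp
  qed
next
  let ?P = "enn2real p" and ?Q = "enn2real (conjugate_index p)"
  assume *: "p \<noteq> \<top>" "conjugate_index p \<noteq> \<top>" "1 < ?P" "1 < ?Q" "1 / ?P + 1 / ?Q = 1"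
  define B where "B = (\<integral>t. \<bar>b t\<bar> powr ?Q \<partial>M)"
  have B0: "B \<ge> 0" by (simp add: B_def)
  have b': "b \<in> borel_measurable M" "integrable M (\<lambda>t. \<bar>b t\<bar> powr ?Q)"
    using b * by (auto simp: Lp_fun_finite_iff)
  note [measurable] = b'(1)
  \<comment> \<open>For \<open>f\<close> scaled to norm 1, Young's bound is 1/P + B/Q; undoing the
    scaling and raising to the power P gives \<open>C\<close>.\<close>
  define C where "C = (1 / ?P + B / ?Q) powr ?P"
  show thesis
  proof (rule that[of C])
    show "C \<ge> 0" by (simp add: C_def)
    fix f assume "f \<in> Lp_fun M p"
    then have f: "f \<in> borel_measurable M" "integrable M (\<lambda>t. \<bar>f t\<bar> powr ?P)"
      using * by (auto simp: Lp_fun_finite_iff)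
    note [measurable] = f(1)
    define F where "F = (\<integral>t. \<bar>f t\<bar> powr ?P \<partial>M)"
    have F0: "F \<ge> 0" by (simp add: F_def)
    show "\<bar>\<integral>t. f t * b t \<partial>M\<bar> powr ?P \<le> C * (\<integral>t. \<bar>f t\<bar> powr ?P \<partial>M)"
    proof (cases "F = 0")
      \<comment> \<open>Norm 0 does not permit scaling, but then \<open>f\<close> vanishes almost
        everywhere.\<close>
      case True
      then have "AE t in M. \<bar>f t\<bar> powr ?P = 0"
        using integral_nonneg_eq_0_iff_AE[OF f(2)] by (simp add: F_def)
      then have "(\<integral>t. f t * b t \<partial>M) = (\<integral>t. 0 \<partial>M)"
        by (intro integral_cong_AE) (auto elim!: eventually_mono)
      then show ?thesis using \<open>C \<ge> 0\<close> by simp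
    next
      case False
      with F0 have F: "F > 0" by simp
      define l where "l = F powr (1 / ?P)"
      have l: "l > 0" "l powr ?P = F" using F * by (auto simp: l_def powr_powr)
      have g: "\<bar>f t / l\<bar> powr ?P = \<bar>f t\<bar> powr ?P / F" for t
        using l by (simp add: powr_divide abs_divide)
      have "\<bar>\<integral>t. (f t / l) * b t \<partial>M\<bar> \<le> (\<integral>t. \<bar>f t / l\<bar> powr ?P \<partial>M) / ?P + (\<integral>t. \<bar>b t\<bar> powr ?Q \<partial>M) / ?Q"
        using * f b' by (intro Youngs_integrable(2)) (auto simp: g simp del: abs_divide)
      also have "(\<integral>t. \<bar>f t / l\<bar> powr ?P \<partial>M) = 1"
        using F by (simp add: g del: abs_divide flip: F_def)
      also have "(\<integral>t. (f t / l) * b t \<partial>M) = (\<integral>t. f t * b t \<partial>M) / l"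
        by simp
      finally have "\<bar>\<integral>t. f t * b t \<partial>M\<bar> \<le> (1 / ?P + B / ?Q) * l"
        using l(1) by (simp add: abs_divide B_def field_simps)
      then have "\<bar>\<integral>t. f t * b t \<partial>M\<bar> powr ?P \<le> ((1 / ?P + B / ?Q) * l) powr ?P"
        using * by (intro powr_mono2) auto
      also have "\<dots> = C * F"
        using l B0 by (simp add: powr_mult C_def)
      finally show ?thesis by (simp add: F_def)
    qed
  qed
qed

section \<open>Product measures\<close>

text \<open>For finite p the p-th power of the inner integral is at most a constant times the
  integral of |f(s, .)|^p, for almost every s, and the latter is integrable in s by Fubini. For p
  infinite, \<open>b\<close> is integrable and almost every section of \<open>f\<close> has the same
  bound.\<close>

lemma (in pair_sigma_finite) Lp_fun_partial_integral:
  assumes p: "1 \<le> p" and f: "f \<in> Lp_fun (M1 \<Otimes>\<^sub>M M2) p" and b: "b \<in> Lp_fun M2 (conjugate_index p)"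
  shows "(\<lambda>s. \<integral>t. f (s, t) * b t \<partial>M2) \<in> Lp_fun M1 p"
proof -
  have [measurable]: "f \<in> borel_measurable (M1 \<Otimes>\<^sub>M M2)" "b \<in> borel_measurable M2"
    using f b by (auto simp: Lp_fun_def)
  have hm [measurable]: "(\<lambda>s. \<integral>t. f (s, t) * b t \<partial>M2) \<in> borel_measurable M1"
    by measurable
  show ?thesis
  proof (cases "p = \<top>")
    case True
    have ib: "integrable M2 b"
      using b True by (auto simp: conjugate_index_def Lp_fun_one_iff)
    from f obtain B where "AE x in M1 \<Otimes>\<^sub>M M2. \<bar>f x\<bar> \<le> B"
      unfolding True Lp_fun_top_iff by auto
    then have "AE s in M1. AE t in M2. \<bar>f (s, t)\<bar> \<le> B"
      by (rule AE_pair)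
    moreover have "AE s in M1. s \<in> space M1" by simp
    ultimately have "AE s in M1. \<bar>\<integral>t. f (s, t) * b t \<partial>M2\<bar> \<le> max 0 (B * (\<integral>t. \<bar>b t\<bar> \<partial>M2))"
    proof eventually_elim
      case (elim s)
      note [measurable] = elim(2)
      from integrable_mult_AE_bounded(2)[OF ib _ elim(1)] show ?case
        by (simp add: mult.commute le_max_iff_disj)
    qed
    with hm show ?thesis
      unfolding True Lp_fun_top_iff by (blast intro: max.cobounded1)
  next
    case False
    let ?P = "enn2real p"
    obtain C where C: "C \<ge> 0" "\<And>f. f \<in> Lp_fun M2 p \<Longrightarrow>
        \<bar>\<integral>t. f t * b t \<partial>M2\<bar> powr ?P \<le> C * (\<integral>t. \<bar>f t\<bar> powr ?P \<partial>M2)"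
      using Lp_fun_mult_integral_bound[OF p False b] by metis
    have fi: "integrable (M1 \<Otimes>\<^sub>M M2) (\<lambda>x. \<bar>f x\<bar> powr ?P)"
      using f False by (simp add: Lp_fun_finite_iff)
    have "integrable M1 (\<lambda>s. \<bar>\<integral>t. f (s, t) * b t \<partial>M2\<bar> powr ?P)"
    proof (rule Bochner_Integration.integrable_bound)
      show "integrable M1 (\<lambda>s. C * (\<integral>t. \<bar>f (s, t)\<bar> powr ?P \<partial>M2))"
        using integrable_fst'[OF fi] by simp
      have "AE s in M1. s \<in> space M1" by simp
      with AE_integrable_fst'[OF fi]
      show "AE s in M1. norm (\<bar>\<integral>t. f (s, t) * b t \<partial>M2\<bar> powr ?P)
          \<le> norm (C * (\<integral>t. \<bar>f (s, t)\<bar> powr ?P \<partial>M2))"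
      proof eventually_elim
        case (elim s)
        note [measurable] = elim(2)
        have "(\<lambda>t. f (s, t)) \<in> Lp_fun M2 p"
          using elim False by (simp add: Lp_fun_finite_iff)
        from C(2)[OF this] show ?case using C(1) by simp
      qed
    qed measurable
    with False hm show ?thesis by (simp add: Lp_fun_finite_iff)
  qed
qed

text \<open>The cylinder over a null set is null: one factor of its product measure is 0, and in
  \<open>ennreal\<close> this absorbs even infinite factors.\<close>

lemma (in product_sigma_finite) AE_PiM_component:
  assumes I: "finite I" "j \<in> I" and P: "AE x in M j. P x"
  shows "AE t in PiM I M. P (t j)"
proof -
  from P obtain N where N: "N \<in> sets (M j)" "emeasure (M j) N = 0" "{x \<in> space (M j). \<not> P x} \<subseteq> N"
    by (auto elim!: AE_E)
  let ?A = "PiE I (\<lambda>i. if i = j then N else space (M i))"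
  have "emeasure (PiM I M) ?A = (\<Prod>i\<in>I. emeasure (M i) (if i = j then N else space (M i)))"
    using I N by (intro emeasure_PiM) auto
  also have "\<dots> = 0"
    using I N by (auto simp: prod_zero_iff intro!: bexI[of _ j])
  finally have "emeasure (PiM I M) ?A = 0" .
  moreover have "?A \<in> sets (PiM I M)"
    using I N by (intro sets_PiM_I_finite) auto
  ultimately have "?A \<in> null_sets (PiM I M)" by auto
  then show ?thesis
    by (rule AE_I') (use N I in \<open>auto simp: space_PiM PiE_iff extensional_def\<close>)
qed

lemma (in product_sigma_finite) Lp_fun_prod:
  assumes I: "finite I" and b: "\<And>j. j \<in> I \<Longrightarrow> b j \<in> Lp_fun (M j) r"
  shows "(\<lambda>t. \<Prod>j\<in>I. b j (t j)) \<in> Lp_fun (PiM I M) r"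
proof -
  have [measurable]: "\<And>j. j \<in> I \<Longrightarrow> b j \<in> borel_measurable (M j)"
    using b by (auto simp: Lp_fun_def)
  have m: "(\<lambda>t. \<Prod>j\<in>I. b j (t j)) \<in> borel_measurable (PiM I M)"
    by measurable
  show ?thesis
  proof (cases "r = \<top>")
    case True
    then have "\<forall>j\<in>I. \<exists>B\<ge>0. AE t in M j. \<bar>b j t\<bar> \<le> B"
      using b by (auto simp: Lp_fun_top_iff)
    then obtain B where B: "\<And>j. j \<in> I \<Longrightarrow> B j \<ge> 0 \<and> (AE t in M j. \<bar>b j t\<bar> \<le> B j)"
      by metis
    have "AE t in PiM I M. \<forall>j\<in>I. \<bar>b j (t j)\<bar> \<le> B j"
      using I B by (intro AE_finite_allI AE_PiM_component) auto
    then have "AE t in PiM I M. \<bar>\<Prod>j\<in>I. b j (t j)\<bar> \<le> (\<Prod>j\<in>I. B j)"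
      by eventually_elim (auto simp: abs_prod intro!: prod_mono)
    with m B show ?thesis
      unfolding True Lp_fun_top_iff by (auto intro!: exI[of _ "\<Prod>j\<in>I. B j"] prod_nonneg)
  next
    case False
    have "integrable (PiM I M) (\<lambda>t. \<Prod>j\<in>I. \<bar>b j (t j)\<bar> powr enn2real r)"
      using I b False by (intro product_integrable_prod) (auto simp: Lp_fun_finite_iff)
    with False m show ?thesis
      by (simp add: Lp_fun_finite_iff abs_prod prod_powr_distrib)
  qed
qed

text \<open>The positive and negative parts of \<open>h\<close> are densities of two finite
  measures. Vanishing integrals make these agree on an intersection-stable generator, hence
  everywhere, and densities are unique almost everywhere. The cover \<open>A\<close> supplies the
  exhaustion when the whole space is not itself in the generator.\<close>

lemma AE_zero_of_generator:
  fixes h :: "'a \<Rightarrow> real" and A :: "nat \<Rightarrow> 'a set"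
  assumes h: "integrable M h" and E: "Int_stable E" "E \<subseteq> Pow (space M)" "sets M = sigma_sets (space M) E"
    and A: "range A \<subseteq> E" "(\<Union>i. A i) = space M"
    and z: "\<And>X. X \<in> E \<Longrightarrow> (\<integral>t. h t * indicator X t \<partial>M) = 0"
  shows "AE t in M. h t = 0"
proof -
  have [measurable]: "h \<in> borel_measurable M" using h by simp
  let ?f = "\<lambda>t. ennreal (max 0 (h t))" and ?g = "\<lambda>t. ennreal (max 0 (- h t))"
  have fin: "(\<integral>\<^sup>+t. ?f t \<partial>M) \<noteq> \<infinity>" "(\<integral>\<^sup>+t. ?g t \<partial>M) \<noteq> \<infinity>"
    using h by (auto simp: nn_integral_eq_integral)
  have "density M ?f = density M ?g"
  proof (rule measure_eqI_generator_eq[OF E(1,2) _ _ _ A])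
    fix X assume X: "X \<in> E"
    then have [measurable]: "X \<in> sets M" using E by auto
    have i: "integrable M (\<lambda>t. max 0 (h t) * indicator X t)" "integrable M (\<lambda>t. max 0 (- h t) * indicator X t)"
      using h by (auto intro!: integrable_real_mult_indicator)
    have "0 = (\<integral>t. max 0 (h t) * indicator X t - max 0 (- h t) * indicator X t \<partial>M)"
      by (subst z[OF X, symmetric], rule Bochner_Integration.integral_cong) (auto simp: max_def indicator_def)
    also have "\<dots> = (\<integral>t. max 0 (h t) * indicator X t \<partial>M) - (\<integral>t. max 0 (- h t) * indicator X t \<partial>M)"
      using i by simp
    finally have "(\<integral>\<^sup>+t. ennreal (max 0 (h t) * indicator X t) \<partial>M)
        = (\<integral>\<^sup>+t. ennreal (max 0 (- h t) * indicator X t) \<partial>M)"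
      using i by (simp add: nn_integral_eq_integral)
    then show "emeasure (density M ?f) X = emeasure (density M ?g) X"
      by (simp add: emeasure_density ennreal_mult'' ennreal_indicator)
  next
    fix i
    have "A i \<in> sets M" using A E by auto
    then have "emeasure (density M ?f) (A i) \<le> emeasure (density M ?f) (space M)"
      by (intro emeasure_mono) (auto dest: sets.sets_into_space)
    also have "\<dots> = (\<integral>\<^sup>+t. ?f t \<partial>M)"
      by (simp add: emeasure_density cong: nn_integral_cong_simp)
    finally show "emeasure (density M ?f) (A i) \<noteq> \<infinity>"
      using fin by (auto simp: top_unique)
  qed (use E in auto)
  then have "AE t in M. ?f t = ?g t"
    using finite_density_unique[of ?f M ?g] fin by auto
  then show ?thesis
    by eventually_elim (auto simp: max_def split: if_splits)
qed

section \<open>Classes of functions\<close>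

definition Lp_class :: "'a measure \<Rightarrow> ennreal \<Rightarrow> ('a \<Rightarrow> real) \<Rightarrow> ('a \<Rightarrow> real) set" where
  "Lp_class M p g = {h \<in> Lp_fun M p. AE t in M. g t = h t}"

text \<open>\<open>rep\<close> is an arbitrary choice, so it recovers \<open>g\<close> only almost
  everywhere; all later facts about norms and integrals of classes pass through this.\<close>

lemma rep_Lp_class:
  assumes "g \<in> Lp_fun M p"
  shows "rep (Lp_class M p g) \<in> Lp_fun M p" and "AE t in M. rep (Lp_class M p g) t = g t"
proof -
  have "g \<in> Lp_class M p g" using assms by (simp add: Lp_class_def)
  then have "rep (Lp_class M p g) \<in> Lp_class M p g"
    unfolding rep_def by (rule someI[where P = "\<lambda>h. h \<in> Lp_class M p g"])
  then show "rep (Lp_class M p g) \<in> Lp_fun M p" "AE t in M. rep (Lp_class M p g) t = g t"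
    by (auto simp: Lp_class_def elim!: eventually_mono)
qed

lemma Lp_class_eqI:
  assumes "AE t in M. g t = h t"
  shows "Lp_class M p g = Lp_class M p h"
  using assms by (auto simp: Lp_class_def elim!: eventually_elim2)

lemma Lp_class_in_Lp_space: "g \<in> Lp_fun M p \<Longrightarrow> Lp_class M p g \<in> Lp_space M p"
  unfolding Lp_space_def Lp_class_def quotient_def by auto

lemma Lp_space_rep:
  assumes "c \<in> Lp_space M p"
  shows "rep c \<in> Lp_fun M p" and "Lp_class M p (rep c) = c"
proof -
  obtain g where g: "g \<in> Lp_fun M p" "c = Lp_class M p g"
    using assms unfolding Lp_space_def Lp_class_def by (auto elim!: quotientE)
  from rep_Lp_class[OF g(1)] show "rep c \<in> Lp_fun M p" "Lp_class M p (rep c) = c"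
    unfolding g(2) by (auto intro!: Lp_class_eqI)
qed

lemma class_norm_Lp_class:
  "g \<in> Lp_fun M p \<Longrightarrow> class_norm M p (Lp_class M p g) = Lp_norm M p g"
  unfolding class_norm_def using rep_Lp_class[of g M p]
  by (intro Lp_norm_AE_cong) (auto simp: Lp_fun_measurable elim!: eventually_mono)

section \<open>Weighted spaces\<close>

text \<open>By Hoelder's inequality this makes the tensor products of such functions integrable
  against the weighted space. For p infinite the exponent is 0, the power of \<open>\<psi>\<close>
  is 1 almost everywhere, and the condition is plain integrability.\<close>

definition admissible :: "real set \<Rightarrow> (real \<Rightarrow> real) \<Rightarrow> ennreal \<Rightarrow> (real \<Rightarrow> real) \<Rightarrow> bool" where
  "admissible D \<psi> p \<phi> \<longleftrightarrow> \<phi> \<in> borel_measurable (restrict_space lborel D) \<and>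
     (\<lambda>t. \<phi> t * \<psi> t powr (- 1 / enn2real p))
       \<in> Lp_fun (restrict_space lborel D) (conjugate_index p)"

text \<open>For \<open>w = u\<close> nothing is integrated out: \<open>leb_prod D {}\<close> is a
  unit point mass, and \<open>g\<close> itself results at every point \<open>s\<close> of the
  domain.\<close>

definition marginal ::
  "real set \<Rightarrow> (real \<Rightarrow> real) \<Rightarrow> nat set \<Rightarrow> nat set \<Rightarrow> ((nat \<Rightarrow> real) \<Rightarrow> real) \<Rightarrow> (nat \<Rightarrow> real) \<Rightarrow> real"
  where "marginal D b u w g s =
    (\<integral>t. g (merge u (w - u) (s, t)) * (\<Prod>j\<in>w - u. b (t j)) \<partial>leb_prod D (w - u))"

text \<open>The assumptions hold for half-open and closed intervals alike.
  \<open>D_exhausted\<close> is an almost-everywhere statement because a right endpoint in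
  \<open>D\<close> has no larger point, and it asks for rational bounds so that later countably many
  cubes suffice.\<close>

locale weighted_domain =
  fixes D :: "real set" and \<psi> :: "real \<Rightarrow> real" and p :: ennreal
  assumes D_sets: "D \<in> sets borel"
    and psi_measurable [measurable]: "\<psi> \<in> borel_measurable (restrict_space lborel D)"
    and psi_nonneg: "x \<in> D \<Longrightarrow> 0 \<le> \<psi> x"
    and psi_pos: "AE x in restrict_space lborel D. 0 < \<psi> x"
    and p_ge_1: "1 \<le> p"
    and zero_in_D: "0 \<in> D"
    and D_nonneg: "x \<in> D \<Longrightarrow> 0 \<le> x"
    and D_downward: "x \<in> D \<Longrightarrow> 0 \<le> y \<Longrightarrow> y \<le> x \<Longrightarrow> y \<in> D"
    and D_exhausted: "AE x in restrict_space lborel D. \<exists>y\<in>D \<inter> \<rat>. x < y"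
    and admissible_anchored: "x \<in> D \<Longrightarrow> admissible D \<psi> p (K_anchored x)"
    and admissible_psi_bar: "admissible D \<psi> p (psi_bar D \<psi>)"
begin

abbreviation "leb \<equiv> restrict_space lborel D"
abbreviation "Lp u \<equiv> Lp_fun (leb_psi D \<psi> u) p"

definition rho :: "real \<Rightarrow> real" where
  "rho x = \<psi> x powr (1 / enn2real p)"

lemma space_leb [simp]: "space leb = D"
  by (simp add: space_restrict_space)

lemma sigma_finite_leb: "sigma_finite_measure leb"
  using D_sets by (intro sigma_finite_measure_restrict_space) (auto intro: sigma_finite_lborel)

sublocale P: product_sigma_finite "\<lambda>_::nat. leb"
  by (rule product_sigma_finite.intro) (rule sigma_finite_leb)

lemma sigma_finite_leb_prod: "finite u \<Longrightarrow> sigma_finite_measure (leb_prod D u)"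
  unfolding leb_prod_def by (rule P.sigma_finite)

lemma rho_measurable [measurable]: "rho \<in> borel_measurable leb"
  unfolding rho_def by measurable

lemma rho_nonneg: "0 \<le> rho x"
  by (simp add: rho_def)

lemma space_leb_prod [simp]: "space (leb_prod D u) = PiE u (\<lambda>_. D)"
  by (simp add: leb_prod_def space_PiM)

lemma space_leb_psi [simp]: "space (leb_psi D \<psi> u) = PiE u (\<lambda>_. D)"
  by (simp add: leb_psi_def)

lemma measurable_leb_psi [simp]:
  "borel_measurable (leb_psi D \<psi> u) = borel_measurable (leb_prod D u)"
  by (simp add: leb_psi_def cong: measurable_cong_sets)

lemma measurable_leb_prod_component [measurable]:
  "j \<in> u \<Longrightarrow> (\<lambda>t. t j) \<in> measurable (leb_prod D u) leb"
  unfolding leb_prod_def by (rule measurable_component_singleton)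

lemma AE_leb_prod_component:
  assumes "finite u" "AE x in leb. P x"
  shows "AE t in leb_prod D u. \<forall>j\<in>u. P (t j)"
  using assms unfolding leb_prod_def by (intro AE_finite_allI P.AE_PiM_component) auto

lemma weight_measurable [measurable]:
  "(\<lambda>t. \<Prod>j\<in>u. ennreal (\<psi> (t j))) \<in> borel_measurable (leb_prod D u)"
  "(\<lambda>t. \<Prod>j\<in>u. \<psi> (t j)) \<in> borel_measurable (leb_prod D u)"
  "(\<lambda>t. \<Prod>j\<in>u. rho (t j)) \<in> borel_measurable (leb_prod D u)"
  by measurable

text \<open>The density is a finite product of factors that are positive almost everywhere, so it
  changes no null sets.\<close>

lemma AE_leb_psi_iff:
  assumes "finite u"
  shows "(AE t in leb_psi D \<psi> u. Q t) \<longleftrightarrow> (AE t in leb_prod D u. Q t)"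
proof -
  have "AE t in leb_prod D u. \<forall>j\<in>u. 0 < \<psi> (t j)"
    by (rule AE_leb_prod_component[OF assms psi_pos])
  then have pos: "AE t in leb_prod D u. 0 < (\<Prod>j\<in>u. ennreal (\<psi> (t j)))"
    by eventually_elim (use assms in \<open>auto simp: zero_less_iff_neq_zero prod_zero_iff ennreal_eq_0_iff\<close>)
  have "(AE t in leb_psi D \<psi> u. Q t) \<longleftrightarrow>
      (AE t in leb_prod D u. 0 < (\<Prod>j\<in>u. ennreal (\<psi> (t j))) \<longrightarrow> Q t)"
    unfolding leb_psi_def by (intro AE_density) measurable
  also have "\<dots> \<longleftrightarrow> (AE t in leb_prod D u. Q t)"
    using pos by (auto elim: eventually_elim2)
  finally show ?thesis .
qed

lemma rho_top:
  assumes "p = \<top>"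
  shows "AE x in leb. rho x = 1"
proof -
  \<comment> \<open>\<open>enn2real\<close> sends infinity to 0, and division by 0 yields 0.\<close>
  have "1 / enn2real p = 0" using assms by simp
  with psi_pos show ?thesis by (auto simp: rho_def elim!: eventually_mono)
qed

text \<open>Absorbing psi^(1/p) into the function trades the weighted measure for the Lebesgue
  product measure. For p infinite the factor is 1 almost everywhere and both measures have the same
  null sets.\<close>

lemma Lp_iff:
  assumes u: "finite u" and g [measurable]: "g \<in> borel_measurable (leb_prod D u)"
  shows "g \<in> Lp u \<longleftrightarrow> (\<lambda>t. g t * (\<Prod>j\<in>u. rho (t j))) \<in> Lp_fun (leb_prod D u) p"
proof (cases "p = \<top>")
  case True
  have "AE t in leb_prod D u. \<forall>j\<in>u. rho (t j) = 1"
    by (rule AE_leb_prod_component[OF u rho_top[OF True]])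
  then have 1: "AE t in leb_prod D u. g t * (\<Prod>j\<in>u. rho (t j)) = g t"
    by eventually_elim simp
  then have 2: "AE t in leb_prod D u. g t = g t * (\<Prod>j\<in>u. rho (t j))"
    by eventually_elim simp
  have "g \<in> Lp u \<longleftrightarrow> g \<in> Lp_fun (leb_prod D u) p"
    using AE_leb_psi_iff[OF u] unfolding True by (simp add: Lp_fun_top_iff)
  also have "\<dots> \<longleftrightarrow> (\<lambda>t. g t * (\<Prod>j\<in>u. rho (t j))) \<in> Lp_fun (leb_prod D u) p"
    using Lp_fun_AE_cong[OF _ _ 1] Lp_fun_AE_cong[OF _ _ 2] by auto
  finally show ?thesis .
next
  case False
  then have P: "1 \<le> enn2real p"
    using p_ge_1 by (cases p) auto
  have w: "leb_psi D \<psi> u = density (leb_prod D u) (\<lambda>t. ennreal (\<Prod>j\<in>u. \<psi> (t j)))"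
    unfolding leb_psi_def
    by (intro density_cong) (auto simp: prod_ennreal psi_nonneg PiE_iff)
  have "integrable (leb_psi D \<psi> u) (\<lambda>t. \<bar>g t\<bar> powr enn2real p) \<longleftrightarrow>
      integrable (leb_prod D u) (\<lambda>t. (\<Prod>j\<in>u. \<psi> (t j)) *\<^sub>R \<bar>g t\<bar> powr enn2real p)"
    unfolding w
    by (intro integrable_density) (auto intro!: AE_I2 prod_nonneg simp: psi_nonneg PiE_iff)
  also have "\<dots> \<longleftrightarrow> integrable (leb_prod D u) (\<lambda>t. \<bar>g t * (\<Prod>j\<in>u. rho (t j))\<bar> powr enn2real p)"
  proof (rule Bochner_Integration.integrable_cong[OF refl])
    fix t assume "t \<in> space (leb_prod D u)"
    then have "rho (t j) powr enn2real p = \<psi> (t j)" if "j \<in> u" for j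
      using that P psi_nonneg[of "t j"] by (auto simp: rho_def powr_powr PiE_iff)
    then show "(\<Prod>j\<in>u. \<psi> (t j)) *\<^sub>R \<bar>g t\<bar> powr enn2real p
        = \<bar>g t * (\<Prod>j\<in>u. rho (t j))\<bar> powr enn2real p"
      by (simp add: abs_mult powr_mult abs_prod rho_nonneg prod_powr_distrib prod_nonneg)
  qed
  finally show ?thesis
    using False by (simp add: Lp_fun_finite_iff)
qed

lemma admissible_quotient:
  assumes "admissible D \<psi> p \<phi>"
  obtains b where "b \<in> Lp_fun leb (conjugate_index p)" "AE x in leb. \<phi> x = b x * rho x"
    and "\<phi> \<in> borel_measurable leb"
proof
  let ?b = "\<lambda>t. \<phi> t * \<psi> t powr (- 1 / enn2real p)"
  show "?b \<in> Lp_fun leb (conjugate_index p)" "\<phi> \<in> borel_measurable leb"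
    using assms by (auto simp: admissible_def)
  show "AE x in leb. \<phi> x = ?b x * rho x"
    using psi_pos by eventually_elim (simp add: rho_def powr_minus field_simps)
qed

lemma admissible_prod_quotient:
  assumes v: "finite v" and "\<And>j. j \<in> v \<Longrightarrow> admissible D \<psi> p (\<phi> j)"
  obtains b where "b \<in> Lp_fun (leb_prod D v) (conjugate_index p)"
    "AE t in leb_prod D v. (\<Prod>j\<in>v. \<phi> j (t j)) = b t * (\<Prod>j\<in>v. rho (t j))"
    "(\<lambda>t. \<Prod>j\<in>v. \<phi> j (t j)) \<in> borel_measurable (leb_prod D v)"
proof -
  have "\<forall>j\<in>v. \<exists>b. b \<in> Lp_fun leb (conjugate_index p) \<and> (AE x in leb. \<phi> j x = b x * rho x)
      \<and> \<phi> j \<in> borel_measurable leb"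
    using admissible_quotient[OF assms(2)] by metis
  then obtain b where b: "\<And>j. j \<in> v \<Longrightarrow> b j \<in> Lp_fun leb (conjugate_index p)"
    "\<And>j. j \<in> v \<Longrightarrow> AE x in leb. \<phi> j x = b j x * rho x"
    "\<And>j. j \<in> v \<Longrightarrow> \<phi> j \<in> borel_measurable leb"
    by metis
  show thesis
  proof
    show "(\<lambda>t. \<Prod>j\<in>v. b j (t j)) \<in> Lp_fun (leb_prod D v) (conjugate_index p)"
      unfolding leb_prod_def using v b(1) by (rule P.Lp_fun_prod)
    have "AE t in leb_prod D v. \<forall>j\<in>v. \<phi> j (t j) = b j (t j) * rho (t j)"
      unfolding leb_prod_def using v b(2) by (intro AE_finite_allI P.AE_PiM_component) auto
    then show "AE t in leb_prod D v. (\<Prod>j\<in>v. \<phi> j (t j)) = (\<Prod>j\<in>v. b j (t j)) * (\<Prod>j\<in>v. rho (t j))"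
      by eventually_elim (simp flip: prod.distrib)
    show "(\<lambda>t. \<Prod>j\<in>v. \<phi> j (t j)) \<in> borel_measurable (leb_prod D v)"
      using b(3) by (intro borel_measurable_prod measurable_compose[OF measurable_leb_prod_component])
  qed
qed

text \<open>The kernel is \<open>b\<close> times the product of \<open>rho\<close>. Moving
  \<open>rho\<close> to \<open>g\<close> leaves a product of an unweighted L_p function with one of
  conjugate index.\<close>

lemma integrable_Lp_kernel:
  assumes u: "finite u" and g: "g \<in> Lp u" and adm: "\<And>j. j \<in> u \<Longrightarrow> admissible D \<psi> p (\<phi> j)"
  shows "integrable (leb_prod D u) (\<lambda>t. g t * (\<Prod>j\<in>u. \<phi> j (t j)))"
proof -
  have [measurable]: "g \<in> borel_measurable (leb_prod D u)"
    using Lp_fun_measurable[OF g] by simp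
  obtain b where b: "b \<in> Lp_fun (leb_prod D u) (conjugate_index p)"
    "AE t in leb_prod D u. (\<Prod>j\<in>u. \<phi> j (t j)) = b t * (\<Prod>j\<in>u. rho (t j))"
    and [measurable]: "(\<lambda>t. \<Prod>j\<in>u. \<phi> j (t j)) \<in> borel_measurable (leb_prod D u)"
    by (rule admissible_prod_quotient[OF u adm])
  have i: "integrable (leb_prod D u) (\<lambda>t. g t * (\<Prod>j\<in>u. rho (t j)) * b t)"
    using g Lp_iff[OF u] by (intro Lp_fun_mult_integrable[OF p_ge_1 _ b(1)]) simp
  moreover have "AE t in leb_prod D u. g t * (\<Prod>j\<in>u. rho (t j)) * b t = g t * (\<Prod>j\<in>u. \<phi> j (t j))"
    using b(2) by eventually_elim simp
  moreover have [measurable]: "b \<in> borel_measurable (leb_prod D u)"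
    using b(1) by (rule Lp_fun_measurable)
  ultimately show ?thesis
    by (intro integrable_cong_AE_imp[OF i]) (auto elim!: eventually_mono)
qed

section \<open>Splitting the variables of a product and integrating some of them out\<close>

lemma merge_measurable [measurable]:
  "merge u v \<in> measurable (leb_prod D u \<Otimes>\<^sub>M leb_prod D v) (leb_prod D (u \<union> v))"
  unfolding leb_prod_def by measurable

lemma merge_in_leb_prod:
  assumes "w = u \<union> v" and g: "g \<in> borel_measurable (leb_prod D w)"
  shows "(\<lambda>x. g (merge u v x)) \<in> borel_measurable (leb_prod D u \<Otimes>\<^sub>M leb_prod D v)"
  using measurable_compose[OF merge_measurable] assms by auto

lemma merge_integrable_iff:
  assumes "w = u \<union> v" "u \<inter> v = {}" "finite u" "finite v"
    and f: "f \<in> borel_measurable (leb_prod D w)"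
  shows "integrable (leb_prod D u \<Otimes>\<^sub>M leb_prod D v) (\<lambda>x. f (merge u v x) :: real)
    \<longleftrightarrow> integrable (leb_prod D w) f"
proof -
  have "leb_prod D w = distr (leb_prod D u \<Otimes>\<^sub>M leb_prod D v) (leb_prod D w) (merge u v)"
    using P.distr_merge[of u v] assms by (simp add: leb_prod_def)
  then show ?thesis
    using integrable_distr_eq[OF merge_measurable, of f u v] f assms(1) by simp
qed

lemma merge_AE:
  assumes "w = u \<union> v" "u \<inter> v = {}" "finite u" "finite v"
    and "AE x in leb_prod D w. Q x"
  shows "AE x in leb_prod D u \<Otimes>\<^sub>M leb_prod D v. Q (merge u v x)"
proof -
  have "leb_prod D w = distr (leb_prod D u \<Otimes>\<^sub>M leb_prod D v) (leb_prod D w) (merge u v)"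
    using P.distr_merge[of u v] assms by (simp add: leb_prod_def)
  then have "AE x in distr (leb_prod D u \<Otimes>\<^sub>M leb_prod D v) (leb_prod D (u \<union> v)) (merge u v). Q x"
    using assms(1,5) by metis
  then show ?thesis by (rule AE_distrD[OF merge_measurable])
qed

lemma Lp_fun_merge:
  assumes w: "w = u \<union> v" "u \<inter> v = {}" "finite u" "finite v"
    and f: "f \<in> Lp_fun (leb_prod D w) p"
  shows "(\<lambda>x. f (merge u v x)) \<in> Lp_fun (leb_prod D u \<Otimes>\<^sub>M leb_prod D v) p"
proof -
  have m: "f \<in> borel_measurable (leb_prod D w)" using f by (rule Lp_fun_measurable)
  note m' = merge_in_leb_prod[OF w(1) m]
  show ?thesis
  proof (cases "p = \<top>")
    case True
    from f obtain B where "B \<ge> 0" "AE t in leb_prod D w. \<bar>f t\<bar> \<le> B"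
      unfolding True Lp_fun_top_iff by auto
    with merge_AE[OF w, of "\<lambda>t. \<bar>f t\<bar> \<le> B"] m' show ?thesis
      unfolding True Lp_fun_top_iff by auto
  next
    case False
    have "(\<lambda>t. \<bar>f t\<bar> powr enn2real p) \<in> borel_measurable (leb_prod D w)"
      using m by measurable
    from merge_integrable_iff[OF w this] f m' False show ?thesis
      by (simp add: Lp_fun_finite_iff)
  qed
qed

lemma prod_merge:
  fixes f :: "real \<Rightarrow> real"
  assumes "u \<inter> v = {}" "finite u" "finite v"
  shows "(\<Prod>j\<in>u \<union> v. f (merge u v (s, t) j)) = (\<Prod>j\<in>u. f (s j)) * (\<Prod>j\<in>v. f (t j))"
proof -
  have "(\<Prod>j\<in>u. f (merge u v (s, t) j)) = (\<Prod>j\<in>u. f (s j))"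
    by (intro prod.cong) (auto simp: merge_def)
  moreover have "(\<Prod>j\<in>v. f (merge u v (s, t) j)) = (\<Prod>j\<in>v. f (t j))"
    using assms by (intro prod.cong) (auto simp: merge_def)
  ultimately show ?thesis using assms by (simp add: prod.union_disjoint)
qed

text \<open>After multiplication by \<open>rho\<close> in all variables of \<open>w\<close>, the
  factors in the variables of \<open>u\<close> leave the inner integral, and those in
  \<open>w - u\<close> combine with \<open>c\<close> to restore the kernel \<open>b\<close>. So the
  marginal times its weight is an unweighted partial integral against \<open>c\<close>, which has
  conjugate index.\<close>

lemma Lp_marginal:
  assumes w: "finite w" "u \<subseteq> w" and g: "g \<in> Lp w" and b: "admissible D \<psi> p b"
  shows "marginal D b u w g \<in> Lp u"
proof -
  define v where "v = w - u"
  have uv: "w = u \<union> v" "u \<inter> v = {}" "finite u" "finite v"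
    using w by (auto simp: v_def intro: finite_subset)
  interpret U: sigma_finite_measure "leb_prod D u" by (rule sigma_finite_leb_prod) fact
  interpret V: sigma_finite_measure "leb_prod D v" by (rule sigma_finite_leb_prod) fact
  interpret UV: pair_sigma_finite "leb_prod D u" "leb_prod D v" ..
  have gm: "g \<in> borel_measurable (leb_prod D w)" using Lp_fun_measurable[OF g] by simp
  note [measurable] = merge_in_leb_prod[OF uv(1) gm]
  obtain c where c: "c \<in> Lp_fun (leb_prod D v) (conjugate_index p)"
    "AE t in leb_prod D v. (\<Prod>j\<in>v. b (t j)) = c t * (\<Prod>j\<in>v. rho (t j))"
    and bm [measurable]: "(\<lambda>t. \<Prod>j\<in>v. b (t j)) \<in> borel_measurable (leb_prod D v)"
    by (rule admissible_prod_quotient[OF uv(4), of "\<lambda>_. b"]) (rule b)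
  have [measurable]: "c \<in> borel_measurable (leb_prod D v)"
    using c(1) by (rule Lp_fun_measurable)
  let ?G = "\<lambda>t. g t * (\<Prod>j\<in>w. rho (t j))"
  have "?G \<in> Lp_fun (leb_prod D w) p"
    using g gm Lp_iff[OF w(1)] by simp
  from UV.Lp_fun_partial_integral[OF p_ge_1 Lp_fun_merge[OF uv this] c(1)]
  have 1: "(\<lambda>s. \<integral>t. ?G (merge u v (s, t)) * c t \<partial>leb_prod D v) \<in> Lp_fun (leb_prod D u) p" .
  have m: "marginal D b u w g = (\<lambda>s. \<integral>t. g (merge u v (s, t)) * (\<Prod>j\<in>v. b (t j)) \<partial>leb_prod D v)"
    by (simp add: marginal_def v_def fun_eq_iff)
  have mm: "marginal D b u w g \<in> borel_measurable (leb_prod D u)"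
    unfolding m by measurable
  have "(\<integral>t. ?G (merge u v (s, t)) * c t \<partial>leb_prod D v) = marginal D b u w g s * (\<Prod>j\<in>u. rho (s j))"
    if s[measurable]: "s \<in> space (leb_prod D u)" for s
  proof -
    have "(\<integral>t. ?G (merge u v (s, t)) * c t \<partial>leb_prod D v)
        = (\<integral>t. (\<Prod>j\<in>u. rho (s j)) * (g (merge u v (s, t)) * (c t * (\<Prod>j\<in>v. rho (t j)))) \<partial>leb_prod D v)"
      unfolding uv(1) prod_merge[OF uv(2-4)] by (simp add: mult_ac)
    also have "\<dots> = (\<Prod>j\<in>u. rho (s j)) * (\<integral>t. g (merge u v (s, t)) * (c t * (\<Prod>j\<in>v. rho (t j))) \<partial>leb_prod D v)"
      by simp
    also have "(\<integral>t. g (merge u v (s, t)) * (c t * (\<Prod>j\<in>v. rho (t j))) \<partial>leb_prod D v) = marginal D b u w g s"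
      unfolding m using c(2) by (intro integral_cong_AE) auto
    finally show ?thesis by simp
  qed
  then have "(\<lambda>s. marginal D b u w g s * (\<Prod>j\<in>u. rho (s j))) \<in> Lp_fun (leb_prod D u) p"
    using mm by (intro Lp_fun_AE_cong[OF 1]) (auto intro!: AE_I2)
  then show ?thesis using Lp_iff[OF uv(3) mm] by simp
qed

lemma integral_marginal:
  assumes w: "finite w" "u \<subseteq> w" and g: "g \<in> Lp w" and b: "admissible D \<psi> p b"
    and k: "\<And>j. j \<in> u \<Longrightarrow> admissible D \<psi> p (k j)"
  shows "(\<integral>t. g t * ((\<Prod>j\<in>u. k j (t j)) * (\<Prod>j\<in>w - u. b (t j))) \<partial>leb_prod D w)
    = (\<integral>s. marginal D b u w g s * (\<Prod>j\<in>u. k j (s j)) \<partial>leb_prod D u)"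
    and "integrable (leb_prod D w) (\<lambda>t. g t * ((\<Prod>j\<in>u. k j (t j)) * (\<Prod>j\<in>w - u. b (t j))))"
proof -
  define v where "v = w - u"
  have uv: "w = u \<union> v" "u \<inter> v = {}" "finite u" "finite v"
    using w by (auto simp: v_def intro: finite_subset)
  let ?f = "\<lambda>t. g t * ((\<Prod>j\<in>u. k j (t j)) * (\<Prod>j\<in>v. b (t j)))"
  \<comment> \<open>The mixed kernel, \<open>k j\<close> on \<open>u\<close> and \<open>b\<close>
    elsewhere, is a single tensor product of admissible functions; its integrability justifies
    Fubini below.\<close>
  have "integrable (leb_prod D w) (\<lambda>t. g t * (\<Prod>j\<in>w. (if j \<in> u then k j else b) (t j)))"
    using g b k w by (intro integrable_Lp_kernel) auto
  also have "(\<lambda>t. g t * (\<Prod>j\<in>w. (if j \<in> u then k j else b) (t j))) = ?f"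
  proof
    fix t
    have "(\<Prod>j\<in>u. (if j \<in> u then k j else b) (t j)) = (\<Prod>j\<in>u. k j (t j))"
      "(\<Prod>j\<in>v. (if j \<in> u then k j else b) (t j)) = (\<Prod>j\<in>v. b (t j))"
      using uv by (auto intro!: prod.cong)
    then show "g t * (\<Prod>j\<in>w. (if j \<in> u then k j else b) (t j)) = ?f t"
      unfolding uv(1) by (simp add: prod.union_disjoint uv)
  qed
  finally have i: "integrable (leb_prod D w) ?f" .
  then show "integrable (leb_prod D w) (\<lambda>t. g t * ((\<Prod>j\<in>u. k j (t j)) * (\<Prod>j\<in>w - u. b (t j))))"
    by (simp add: v_def)
  have "(\<integral>t. ?f t \<partial>leb_prod D w) = (\<integral>s. (\<integral>t. ?f (merge u v (s, t)) \<partial>leb_prod D v) \<partial>leb_prod D u)"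
    using P.product_integral_fold[OF uv(2-4), of ?f] i by (simp add: uv(1) leb_prod_def)
  also have "\<dots> = (\<integral>s. marginal D b u w g s * (\<Prod>j\<in>u. k j (s j)) \<partial>leb_prod D u)"
  proof (rule Bochner_Integration.integral_cong[OF refl])
    fix s
    have "(\<Prod>j\<in>u. k j (merge u v (s, t) j)) = (\<Prod>j\<in>u. k j (s j))"
      "(\<Prod>j\<in>v. b (merge u v (s, t) j)) = (\<Prod>j\<in>v. b (t j))" for t
      using uv(2) by (auto intro!: prod.cong simp: merge_def)
    then have "(\<integral>t. ?f (merge u v (s, t)) \<partial>leb_prod D v)
        = (\<integral>t. (g (merge u v (s, t)) * (\<Prod>j\<in>v. b (t j))) * (\<Prod>j\<in>u. k j (s j)) \<partial>leb_prod D v)"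
      by (simp add: mult_ac)
    then show "(\<integral>t. ?f (merge u v (s, t)) \<partial>leb_prod D v)
        = marginal D b u w g s * (\<Prod>j\<in>u. k j (s j))"
      by (simp add: marginal_def v_def)
  qed
  finally show "(\<integral>t. g t * ((\<Prod>j\<in>u. k j (t j)) * (\<Prod>j\<in>w - u. b (t j))) \<partial>leb_prod D w)
    = (\<integral>s. marginal D b u w g s * (\<Prod>j\<in>u. k j (s j)) \<partial>leb_prod D u)"
    by (simp add: v_def)
qed

text \<open>In the expanded product, \<open>u\<close> is the set of variables that keep the factor
  \<open>k j\<close>. The constant \<open>c\<close> is left open so that the passage from one kernel
  to the other (-1) and the way back (1) are both instances.\<close>

lemma integral_shifted_kernel:
  assumes w: "finite w" and g: "g \<in> Lp w" and b: "admissible D \<psi> p b"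
    and k: "\<And>j. j \<in> w \<Longrightarrow> admissible D \<psi> p (k j)"
  shows "(\<integral>t. g t * (\<Prod>j\<in>w. k j (t j) + c * b (t j)) \<partial>leb_prod D w)
    = (\<Sum>u\<in>Pow w. c ^ card (w - u) * (\<integral>s. marginal D b u w g s * (\<Prod>j\<in>u. k j (s j)) \<partial>leb_prod D u))"
proof -
  let ?f = "\<lambda>u t. g t * ((\<Prod>j\<in>u. k j (t j)) * (\<Prod>j\<in>w - u. b (t j)))"
  have i: "integrable (leb_prod D w) (?f u)" if "u \<in> Pow w" for u
    using that k by (intro integral_marginal(2)[OF w _ g b]) auto
  have "(\<integral>t. g t * (\<Prod>j\<in>w. k j (t j) + c * b (t j)) \<partial>leb_prod D w)
      = (\<integral>t. (\<Sum>u\<in>Pow w. c ^ card (w - u) * ?f u t) \<partial>leb_prod D w)"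
    by (simp add: prod_add[OF w] prod.distrib sum_distrib_left mult_ac)
  also have "\<dots> = (\<Sum>u\<in>Pow w. c ^ card (w - u) * (\<integral>t. ?f u t \<partial>leb_prod D w))"
    using i by (subst Bochner_Integration.integral_sum) auto
  also have "\<dots> = (\<Sum>u\<in>Pow w. c ^ card (w - u) *
      (\<integral>s. marginal D b u w g s * (\<Prod>j\<in>u. k j (s j)) \<partial>leb_prod D u))"
    using k by (intro sum.cong refl arg_cong2[where f = times] integral_marginal(1)[OF w _ g b]) auto
  finally show ?thesis .
qed

end

section \<open>Boxes at the anchor determine a function\<close>

context weighted_domain
begin

lemma admissible_anova: "x \<in> D \<Longrightarrow> admissible D \<psi> p (K_anova D \<psi> x)"
  using admissible_anchored[of x] admissible_psi_bar
    Lp_fun_diff[of "\<lambda>t. K_anchored x t * \<psi> t powr (- 1 / enn2real p)" leb "conjugate_index p"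
      "\<lambda>t. psi_bar D \<psi> t * \<psi> t powr (- 1 / enn2real p)"]
  by (auto simp: admissible_def K_anova_def [abs_def] K_anchored_def [abs_def] left_diff_distrib)

lemma admissible_measurable: "admissible D \<psi> p \<phi> \<Longrightarrow> \<phi> \<in> borel_measurable leb"
  by (simp add: admissible_def)

text \<open>Since \<open>D\<close> contains no negative points, these traces of half-lines are
  exactly the traces of the intervals [0, a) on which the anchored kernel lives.\<close>

lemma sets_leb_generated: "sets leb = sigma_sets D (range (\<lambda>a. D \<inter> {..<a}))"
proof -
  have borel: "sets (borel :: real measure) = sigma_sets UNIV (range lessThan)"
    by (simp add: borel_Iio)
  have "sets leb = (\<inter>) D ` sigma_sets UNIV (range lessThan)"
    by (simp add: sets_restrict_space borel)
  also have "\<dots> = sigma_sets D ((\<inter>) D ` range lessThan)"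
    using D_sets borel by (intro sigma_sets_Int) auto
  finally show ?thesis by (simp add: image_image)
qed

text \<open>A finite product of generated sigma-algebras is generated by the boxes over the
  generators once each factor space is a countable union of generator sets, here of the traces of
  the half-lines below the natural numbers.\<close>

lemma sets_leb_prod_generated:
  assumes u: "finite u"
  shows "sets (leb_prod D u) =
    sigma_sets (PiE u (\<lambda>_. D)) {PiE u F |F. \<forall>i\<in>u. F i \<in> range (\<lambda>a. D \<inter> {..<a})}"
proof -
  let ?E = "range (\<lambda>a. D \<inter> {..<a})"
  let ?P = "{{f \<in> PiE u (\<lambda>_. D). \<forall>i\<in>j. f i \<in> F i} |F j. j \<in> {u} \<and> F \<in> Pi j (\<lambda>_. ?E)}"
  have "sets (leb_prod D u) = sets (PiM u (\<lambda>_. sigma D ?E))"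
    unfolding leb_prod_def
  proof (intro sets_PiM_cong refl)
    have "?E \<subseteq> Pow D" by blast
    then show "sets leb = sets (sigma D ?E)"
      by (simp only: sets_leb_generated sets_measure_of)
  qed
  also have "\<dots> = sets (sigma (PiE u (\<lambda>_. D)) ?P)"
  proof (rule sets_PiM_sigma)
    have "D = (\<Union>n. D \<inter> {..<real n})"
      using reals_Archimedean2 by auto
    moreover have "range (\<lambda>n. D \<inter> {..<real n}) \<subseteq> ?E" by blast
    moreover have "countable (range (\<lambda>n. D \<inter> {..<real n}))" by simp
    ultimately show "\<exists>S\<subseteq>?E. countable S \<and> D = \<Union>S" by blast
  next
    show "?E \<subseteq> Pow D" by blast
  qed (use u in simp_all)
  also have "\<dots> = sigma_sets (PiE u (\<lambda>_. D)) ?P"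
    by (intro sets_measure_of) blast
  also have "?P = {PiE u F |F. \<forall>i\<in>u. F i \<in> ?E}"
  proof -
    have eq: "{f \<in> PiE u (\<lambda>_. D). \<forall>i\<in>u. f i \<in> F i} = PiE u F" if "\<forall>i\<in>u. F i \<in> ?E" for F
    proof -
      have "F i \<subseteq> D" if "i \<in> u" for i using that \<open>\<forall>i\<in>u. F i \<in> ?E\<close> by blast
      then show ?thesis by (auto simp: PiE_iff extensional_def)
    qed
    show ?thesis
    proof (intro set_eqI iffI)
      fix X assume "X \<in> ?P"
      then obtain F where F: "X = {f \<in> PiE u (\<lambda>_. D). \<forall>i\<in>u. f i \<in> F i}" "\<forall>i\<in>u. F i \<in> ?E"
        by blast
      from F(1) show "X \<in> {PiE u F |F. \<forall>i\<in>u. F i \<in> ?E}"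
        unfolding eq[OF F(2)] using F(2) by blast
    next
      fix X assume "X \<in> {PiE u F |F. \<forall>i\<in>u. F i \<in> ?E}"
      then obtain F where F: "X = PiE u F" "\<forall>i\<in>u. F i \<in> ?E" by blast
      then have "F \<in> Pi u (\<lambda>_. ?E)" by blast
      with F(1) show "X \<in> ?P" unfolding eq[OF F(2), symmetric] by blast
    qed
  qed
  finally show ?thesis .
qed

text \<open>Membership in the weighted space does not provide integrability over the whole domain,
  so the uniqueness principle is applied to \<open>g\<close> cut off to a cube [0, y)^u. Cubes with
  rational side then exhaust almost all of the domain.\<close>

lemma box_integrals_zero:
  assumes u: "finite u" and g: "g \<in> Lp u"
    and z: "\<And>x. x \<in> PiE u (\<lambda>_. D) \<Longrightarrow>
      (\<integral>t. g t * (\<Prod>j\<in>u. K_anchored (x j) (t j)) \<partial>leb_prod D u) = 0"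
  shows "AE t in leb_prod D u. g t = 0"
proof -
  have below: "AE t in leb_prod D u. (\<forall>j\<in>u. t j < y) \<longrightarrow> g t = 0" if y: "y \<in> D" for y
  proof -
    let ?h = "\<lambda>t. g t * (\<Prod>j\<in>u. K_anchored y (t j))"
    define E where "E = {PiE u F |F. \<forall>i\<in>u. F i \<in> range (\<lambda>a. D \<inter> {..<a})}"
    have "AE t in leb_prod D u. ?h t = 0"
    proof (rule AE_zero_of_generator[where E = E and A = "\<lambda>n. PiE u (\<lambda>_. D \<inter> {..<real n})"])
      show "integrable (leb_prod D u) ?h"
        using u g y by (intro integrable_Lp_kernel admissible_anchored)
      show "Int_stable E"
      proof (rule Int_stableI)
        fix X Y assume "X \<in> E" "Y \<in> E"
        then obtain F G where FG: "X = PiE u F" "Y = PiE u G"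
          "\<forall>i\<in>u. F i \<in> range (\<lambda>a. D \<inter> {..<a})" "\<forall>i\<in>u. G i \<in> range (\<lambda>a. D \<inter> {..<a})"
          by (auto simp: E_def)
        have "F i \<inter> G i \<in> range (\<lambda>a. D \<inter> {..<a})" if i: "i \<in> u" for i
        proof -
          from FG i obtain a b where "F i = D \<inter> {..<a}" "G i = D \<inter> {..<b}" by blast
          then have "F i \<inter> G i = D \<inter> {..<min a b}" by auto
          then show ?thesis by blast
        qed
        with FG show "X \<inter> Y \<in> E"
          by (auto simp: E_def PiE_Int intro!: exI[of _ "\<lambda>i. F i \<inter> G i"])
      qed
      show "E \<subseteq> Pow (space (leb_prod D u))"
        by (auto simp: E_def PiE_iff)
      show "sets (leb_prod D u) = sigma_sets (space (leb_prod D u)) E"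
        unfolding E_def space_leb_prod by (rule sets_leb_prod_generated[OF u])
      show "range (\<lambda>n. PiE u (\<lambda>_. D \<inter> {..<real n})) \<subseteq> E"
        by (auto simp: E_def)
      show "(\<Union>n. PiE u (\<lambda>_. D \<inter> {..<real n})) = space (leb_prod D u)"
      proof (intro equalityI subsetI)
        fix t assume t: "t \<in> space (leb_prod D u)"
        obtain n where n: "Max (insert 0 (t ` u)) < real n"
          using reals_Archimedean2 by blast
        have "t j < real n" if "j \<in> u" for j
          using n u that by (subst (asm) Max_less_iff) auto
        with t show "t \<in> (\<Union>n. PiE u (\<lambda>_. D \<inter> {..<real n}))"
          by (auto simp: PiE_iff)
      qed (auto simp: PiE_iff)
      fix X assume "X \<in> E"
      then obtain F where F: "X = PiE u F" "\<forall>i\<in>u. F i \<in> range (\<lambda>a. D \<inter> {..<a})"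
        by (auto simp: E_def)
      then have "\<forall>i\<in>u. \<exists>a. F i = D \<inter> {..<a}" by blast
      then obtain a where a: "\<And>i. i \<in> u \<Longrightarrow> F i = D \<inter> {..<a i}"
        by (meson bchoice)
      \<comment> \<open>Intersecting [0, y) with the points below \<open>a j\<close> gives [0, min y
        (a j)). The maximum with 0 keeps the corner in \<open>D\<close> for negative
        \<open>a j\<close>, where the interval is empty.\<close>
      define x where "x = (\<lambda>j\<in>u. max 0 (min y (a j)))"
      have x: "x \<in> PiE u (\<lambda>_. D)"
        using y zero_in_D D_nonneg[OF y] by (auto simp: x_def intro!: D_downward[OF y])
      have "(\<integral>t. ?h t * indicator X t \<partial>leb_prod D u)
          = (\<integral>t. g t * (\<Prod>j\<in>u. K_anchored (x j) (t j)) \<partial>leb_prod D u)"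
      proof (rule Bochner_Integration.integral_cong[OF refl])
        fix t assume t: "t \<in> space (leb_prod D u)"
        then have "indicator X t = (\<Prod>j\<in>u. indicator (F j) (t j) :: real)"
          unfolding F(1) using u by (auto simp: indicator_def PiE_iff prod_zero_iff)
        moreover have "K_anchored y (t j) * indicator (F j) (t j) = K_anchored (x j) (t j)"
          if "j \<in> u" for j
        proof -
          have "t j \<in> D" using t that by (auto simp: PiE_iff)
          with D_nonneg[of "t j"] a[OF that] that show ?thesis
            by (simp add: K_anchored_def indicator_def x_def less_max_iff_disj)
        qed
        ultimately show "?h t * indicator X t = g t * (\<Prod>j\<in>u. K_anchored (x j) (t j))"
          by (simp add: mult.assoc flip: prod.distrib)
      qed
      with z[OF x] show "(\<integral>t. ?h t * indicator X t \<partial>leb_prod D u) = 0" by simp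
    qed
    moreover have "AE t in leb_prod D u. t \<in> space (leb_prod D u)" by (rule AE_space)
    ultimately show ?thesis
    proof eventually_elim
      case (elim t)
      show ?case
      proof
        assume "\<forall>j\<in>u. t j < y"
        then have "(\<Prod>j\<in>u. K_anchored y (t j)) = 1"
          using elim(2) D_nonneg by (intro prod.neutral) (auto simp: K_anchored_def PiE_iff)
        with elim(1) show "g t = 0" by simp
      qed
    qed
  qed
  \<comment> \<open>Only countably many \<open>y\<close> occur, so their exceptional sets unite to a
    null set.\<close>
  have "AE t in leb_prod D u. \<forall>y\<in>D \<inter> \<rat>. (\<forall>j\<in>u. t j < y) \<longrightarrow> g t = 0"
    using below by (subst AE_ball_countable) (auto intro: countable_Int2 countable_rat)
  moreover have "AE t in leb_prod D u. \<forall>j\<in>u. \<exists>y\<in>D \<inter> \<rat>. t j < y"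
    by (rule AE_leb_prod_component[OF u D_exhausted])
  ultimately show ?thesis
  proof eventually_elim
    case (elim t)
    from elim(2) obtain y where y: "\<And>j. j \<in> u \<Longrightarrow> y j \<in> D \<inter> \<rat> \<and> t j < y j"
      by metis
    \<comment> \<open>\<open>below\<close> needs one bound for all coordinates. The maximum of the
      chosen bounds is again rational and in \<open>D\<close>; inserting 0 covers the empty
      \<open>u\<close>.\<close>
    define m where "m = Max (insert 0 (y ` u))"
    have "m \<in> insert 0 (y ` u)"
      unfolding m_def using u by (intro Max_in) auto
    then have "m \<in> D \<inter> \<rat>"
      using y zero_in_D by auto
    moreover have "t j < m" if "j \<in> u" for j
    proof -
      have "y j \<le> m" unfolding m_def using u that by (intro Max_ge) auto
      with y[OF that] show ?thesis by simp
    qed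
    ultimately show ?case using elim(1) by blast
  qed
qed

end

section \<open>Families over the active index sets and the change of kernel\<close>

locale weighted_family = weighted_domain +
  fixes d :: nat and \<gamma> :: "nat set \<Rightarrow> real"
  assumes active_downward: "w \<in> active d \<gamma> \<Longrightarrow> u \<subseteq> w \<Longrightarrow> u \<in> active d \<gamma>"
begin

abbreviation "A \<equiv> active d \<gamma>"
abbreviation "L \<equiv> ell D \<psi> d \<gamma> p"

lemma finite_A [simp]: "finite A"
  by (rule finite_subset[of _ "Pow {1..d}"]) (auto simp: active_def)

lemma finite_active: "u \<in> A \<Longrightarrow> finite u"
  by (auto simp: active_def intro: finite_subset)

definition Lp_family :: "(nat set \<Rightarrow> (nat \<Rightarrow> real) \<Rightarrow> real) \<Rightarrow> bool" where
  "Lp_family g \<longleftrightarrow> (\<forall>u\<in>A. g u \<in> Lp u)"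

definition classes :: "(nat set \<Rightarrow> (nat \<Rightarrow> real) \<Rightarrow> real) \<Rightarrow> family" where
  "classes g = (\<lambda>u\<in>A. Lp_class (leb_psi D \<psi> u) p (g u))"

text \<open>\<open>J (- 1)\<close> represents the operator \<open>j\<close> and \<open>J 1\<close>
  its inverse; keeping \<open>c\<close> as a parameter turns the symmetry between them into a
  statement about the sign of \<open>c\<close>.\<close>

definition J ::
  "real \<Rightarrow> (nat set \<Rightarrow> (nat \<Rightarrow> real) \<Rightarrow> real) \<Rightarrow> nat set \<Rightarrow> (nat \<Rightarrow> real) \<Rightarrow> real" where
  "J c g u s = (\<Sum>w\<in>{w\<in>A. u \<subseteq> w}. c ^ card (w - u) * marginal D (psi_bar D \<psi>) u w (g w) s)"

definition alternate ::
  "(nat set \<Rightarrow> (nat \<Rightarrow> real) \<Rightarrow> real) \<Rightarrow> nat set \<Rightarrow> (nat \<Rightarrow> real) \<Rightarrow> real" where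
  "alternate g u t = (- 1) ^ card u * g u t"

lemma Lp_family_J:
  assumes "Lp_family g"
  shows "Lp_family (J c g)"
  unfolding Lp_family_def
proof
  fix u assume "u \<in> A"
  have "(\<lambda>s. c ^ card (w - u) * marginal D (psi_bar D \<psi>) u w (g w) s) \<in> Lp u"
    if "w \<in> {w\<in>A. u \<subseteq> w}" for w
    using that assms
    by (intro Lp_fun_cmult Lp_marginal admissible_psi_bar) (auto simp: Lp_family_def finite_active)
  then have "(\<lambda>s. \<Sum>w\<in>{w\<in>A. u \<subseteq> w}. c ^ card (w - u) * marginal D (psi_bar D \<psi>) u w (g w) s) \<in> Lp u"
    by (intro Lp_fun_sum) auto
  then show "J c g u \<in> Lp u" by (simp add: J_def [abs_def])
qed

lemma Lp_family_alternate: "Lp_family g \<Longrightarrow> Lp_family (alternate g)"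
  by (auto simp: Lp_family_def alternate_def [abs_def] intro: Lp_fun_cmult)

lemma alternate_alternate [simp]: "alternate (alternate g) = g"
  by (simp add: alternate_def fun_eq_iff flip: power_mult_distrib mult.assoc)

text \<open>As |w| = |u| + |w - u|, the sign attached to \<open>w\<close> splits into the sign of
  \<open>u\<close> and one factor -1 for every variable integrated out, which joins the power of
  \<open>c\<close>.\<close>

lemma J_alternate: "J c (alternate g) = alternate (J (- c) g)"
proof (intro ext)
  fix u s
  have "c ^ card (w - u) * marginal D (psi_bar D \<psi>) u w (alternate g w) s
      = (- 1) ^ card u * ((- c) ^ card (w - u) * marginal D (psi_bar D \<psi>) u w (g w) s)"
    if w: "w \<in> A" "u \<subseteq> w" for w
  proof -
    have fin: "finite w" "finite u" using w by (auto simp: finite_active intro: finite_subset)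
    have "card w = card u + card (w - u)"
      using w fin by (simp add: card_Diff_subset card_mono)
    then have "c ^ card (w - u) * (- 1) ^ card w = (- 1) ^ card u * (- c) ^ card (w - u)"
      by (simp add: power_add power_minus[of c])
    moreover have "marginal D (psi_bar D \<psi>) u w (alternate g w) s
        = (- 1) ^ card w * marginal D (psi_bar D \<psi>) u w (g w) s"
      by (simp add: marginal_def alternate_def mult.assoc)
    ultimately show ?thesis by (metis mult.assoc)
  qed
  then show "J c (alternate g) u s = alternate (J (- c) g) u s"
    by (simp add: J_def alternate_def sum_distrib_left)
qed

text \<open>Expanding the kernel lets each index \<open>w\<close> contribute to all its subsets;
  exchanging the two sums collects the contributions to a fixed \<open>u\<close> into
  \<open>J c g u\<close>.\<close>

lemma kernel_change:
  assumes g: "Lp_family g" and x: "x \<in> PiE {1..d} (\<lambda>_. D)"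
    and k': "\<And>y. y \<in> D \<Longrightarrow> admissible D \<psi> p (k' y)"
    and k: "\<And>y t. k y t = k' y t + c * psi_bar D \<psi> t"
  shows "(\<Sum>w\<in>A. \<integral>t. g w t * (\<Prod>j\<in>w. k (x j) (t j)) \<partial>leb_prod D w)
    = (\<Sum>u\<in>A. \<integral>t. J c g u t * (\<Prod>j\<in>u. k' (x j) (t j)) \<partial>leb_prod D u)"
proof -
  let ?m = "\<lambda>u w. marginal D (psi_bar D \<psi>) u w (g w)"
  let ?I = "\<lambda>u w. c ^ card (w - u) * (\<integral>s. ?m u w s * (\<Prod>j\<in>u. k' (x j) (s j)) \<partial>leb_prod D u)"
  have adm: "admissible D \<psi> p (k' (x j))" if "j \<in> w" "w \<in> A" for j w
    using that x by (intro k') (auto simp: active_def)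
  have "(\<Sum>w\<in>A. \<integral>t. g w t * (\<Prod>j\<in>w. k (x j) (t j)) \<partial>leb_prod D w) = (\<Sum>w\<in>A. \<Sum>u\<in>Pow w. ?I u w)"
    unfolding k using g adm
    by (intro sum.cong refl integral_shifted_kernel admissible_psi_bar)
      (auto simp: Lp_family_def finite_active)
  \<comment> \<open>Subsets of active sets are active, so the expansion creates no index outside the
    family. This is where the assumption on the weights enters.\<close>
  also have "\<dots> = (\<Sum>w\<in>A. \<Sum>u\<in>{u\<in>A. u \<subseteq> w}. ?I u w)"
    using active_downward by (intro sum.cong) auto
  also have "\<dots> = (\<Sum>u\<in>A. \<Sum>w\<in>{w\<in>A. u \<subseteq> w}. ?I u w)"
    by (rule sum.swap_restrict) auto
  also have "\<dots> = (\<Sum>u\<in>A. \<integral>t. J c g u t * (\<Prod>j\<in>u. k' (x j) (t j)) \<partial>leb_prod D u)"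
  proof (rule sum.cong[OF refl])
    fix u assume u: "u \<in> A"
    have i: "integrable (leb_prod D u) (\<lambda>s. ?m u w s * (\<Prod>j\<in>u. k' (x j) (s j)))"
      if "w \<in> {w\<in>A. u \<subseteq> w}" for w
      using that u g adm
      by (intro integrable_Lp_kernel Lp_marginal admissible_psi_bar)
        (auto simp: Lp_family_def finite_active)
    have "(\<integral>t. J c g u t * (\<Prod>j\<in>u. k' (x j) (t j)) \<partial>leb_prod D u)
        = (\<integral>t. (\<Sum>w\<in>{w\<in>A. u \<subseteq> w}. c ^ card (w - u) * (?m u w t * (\<Prod>j\<in>u. k' (x j) (t j)))) \<partial>leb_prod D u)"
      by (simp add: J_def sum_distrib_right mult.assoc)
    also have "\<dots> = (\<Sum>w\<in>{w\<in>A. u \<subseteq> w}. ?I u w)"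
      using i by (subst Bochner_Integration.integral_sum) auto
    finally show "(\<Sum>w\<in>{w\<in>A. u \<subseteq> w}. ?I u w)
        = (\<integral>t. J c g u t * (\<Prod>j\<in>u. k' (x j) (t j)) \<partial>leb_prod D u)" ..
  qed
  finally show ?thesis .
qed

section \<open>From families of functions to families of classes\<close>

lemma classes_in_ell: "Lp_family g \<Longrightarrow> classes g \<in> L"
  by (auto simp: classes_def ell_def Lp_family_def intro!: Lp_class_in_Lp_space)

lemma ell_classes:
  assumes "G \<in> L"
  obtains g where "Lp_family g" "G = classes g"
proof
  have G: "G u \<in> Lp_space (leb_psi D \<psi> u) p" if "u \<in> A" for u
    using assms that by (auto simp: ell_def)
  show "Lp_family (\<lambda>u. rep (G u))"
    using Lp_space_rep(1)[OF G] by (simp add: Lp_family_def)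
  show "G = classes (\<lambda>u. rep (G u))"
  proof
    fix u show "G u = classes (\<lambda>u. rep (G u)) u"
      using assms Lp_space_rep(2)[OF G] by (cases "u \<in> A") (auto simp: classes_def ell_def PiE_iff extensional_def)
  qed
qed

lemma classes_eq_iff:
  assumes "Lp_family g" "Lp_family h"
  shows "classes g = classes h \<longleftrightarrow> (\<forall>u\<in>A. AE t in leb_psi D \<psi> u. g u t = h u t)"
proof
  assume eq: "classes g = classes h"
  show "\<forall>u\<in>A. AE t in leb_psi D \<psi> u. g u t = h u t"
  proof
    fix u assume u: "u \<in> A"
    then have "Lp_class (leb_psi D \<psi> u) p (g u) = Lp_class (leb_psi D \<psi> u) p (h u)"
      using fun_cong[OF eq, of u] by (simp add: classes_def)
    moreover have "h u \<in> Lp_class (leb_psi D \<psi> u) p (h u)"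
      using assms u by (simp add: Lp_class_def Lp_family_def)
    ultimately have "h u \<in> Lp_class (leb_psi D \<psi> u) p (g u)" by simp
    then show "AE t in leb_psi D \<psi> u. g u t = h u t"
      by (simp add: Lp_class_def)
  qed
qed (auto simp: classes_def fun_eq_iff restrict_def intro!: Lp_class_eqI)

lemma classes_alternate_cong:
  assumes "Lp_family g" "Lp_family h" "classes g = classes h"
  shows "classes (alternate g) = classes (alternate h)"
  using assms by (auto simp: classes_eq_iff Lp_family_alternate alternate_def elim: eventually_mono)

lemma class_norm_classes:
  assumes "Lp_family g" "u \<in> A"
  shows "class_norm (leb_psi D \<psi> u) p (classes g u) = Lp_norm (leb_psi D \<psi> u) p (g u)"
  using assms by (simp add: classes_def Lp_family_def class_norm_Lp_class)

text \<open>The Lebesgue norms see only absolute values, so each term of the norm is unchanged,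
  whatever q is.\<close>

lemma ell_norm_alternate:
  assumes "Lp_family g"
  shows "ell_norm D \<psi> d \<gamma> p q (classes (alternate g)) = ell_norm D \<psi> d \<gamma> p q (classes g)"
proof -
  have n: "class_norm (leb_psi D \<psi> u) p (classes (alternate g) u) = class_norm (leb_psi D \<psi> u) p (classes g u)"
    if "u \<in> A" for u
    using that assms
    by (simp add: class_norm_classes Lp_family_alternate)
      (simp add: Lp_norm_def alternate_def abs_mult power_abs)
  show ?thesis
    unfolding ell_norm_def using n by (auto cong: image_cong sum.cong)
qed

text \<open>\<open>T_op\<close> integrates a chosen representative over \<open>leb_prod\<close>,
  whereas classes are formed over \<open>leb_psi\<close>. The two measures share their null sets, so
  the choice does not affect the integral.\<close>

lemma T_sum_classes:
  assumes g: "Lp_family g" and K: "\<And>y. y \<in> D \<Longrightarrow> admissible D \<psi> p (K y)"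
  shows "T_sum K D d \<gamma> (classes g) =
    (\<lambda>x\<in>PiE {1..d} (\<lambda>_. D). \<Sum>u\<in>A. \<integral>t. g u t * (\<Prod>j\<in>u. K (x j) (t j)) \<partial>leb_prod D u)"
proof -
  have "T_op K D u (classes g u) x = (\<integral>t. g u t * (\<Prod>j\<in>u. K (x j) (t j)) \<partial>leb_prod D u)"
    if u: "u \<in> A" and x: "x \<in> PiE {1..d} (\<lambda>_. D)" for u x
  proof -
    have gu: "g u \<in> Lp u" using g u by (simp add: Lp_family_def)
    note r = rep_Lp_class[OF gu]
    have [measurable]: "K (x j) \<in> borel_measurable leb" if "j \<in> u" for j
      using that u x by (intro admissible_measurable K) (auto simp: active_def)
    have [measurable]: "g u \<in> borel_measurable (leb_prod D u)"
      "rep (Lp_class (leb_psi D \<psi> u) p (g u)) \<in> borel_measurable (leb_prod D u)"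
      using Lp_fun_measurable[OF gu] Lp_fun_measurable[OF r(1)] by auto
    have [measurable]: "(\<lambda>t. \<Prod>j\<in>u. K (x j) (t j)) \<in> borel_measurable (leb_prod D u)"
      by (intro borel_measurable_prod measurable_compose[OF measurable_leb_prod_component]) auto
    have "AE t in leb_prod D u. rep (Lp_class (leb_psi D \<psi> u) p (g u)) t = g u t"
      using r(2) AE_leb_psi_iff finite_active[OF u] by simp
    then show ?thesis
      unfolding T_op_def using u by (intro integral_cong_AE) (auto simp: classes_def)
  qed
  then show ?thesis
    unfolding T_sum_def by (intro restrict_ext sum.cong) auto
qed

section \<open>The two representations and the inverse pair on classes\<close>

abbreviation "T\<^sub>0 \<equiv> T_sum K_anchored D d \<gamma>"
abbreviation "T\<^sub>A \<equiv> T_sum (K_anova D \<psi>) D d \<gamma>"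

lemma T_anchored_J: "Lp_family g \<Longrightarrow> T\<^sub>0 (classes (J (- 1) g)) = T\<^sub>A (classes g)"
  using kernel_change[where k = "K_anova D \<psi>" and k' = K_anchored and c = "- 1"]
  by (simp add: T_sum_classes Lp_family_J admissible_anchored admissible_anova
      K_anova_def K_anchored_def cong: restrict_cong)

lemma T_anova_J: "Lp_family g \<Longrightarrow> T\<^sub>A (classes (J 1 g)) = T\<^sub>0 (classes g)"
  using kernel_change[where k' = "K_anova D \<psi>" and k = K_anchored and c = 1]
  by (simp add: T_sum_classes Lp_family_J admissible_anchored admissible_anova
      K_anova_def K_anchored_def cong: restrict_cong)

text \<open>
  Setting the coordinates outside \<open>u\<close> to the anchor \<open>0\<close> kills all terms except those with
  index set contained in \<open>u\<close>.
\<close>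

lemma anchored_sum_zero:
  assumes g: "Lp_family g"
    and z: "\<And>x. x \<in> PiE {1..d} (\<lambda>_. D) \<Longrightarrow>
      (\<Sum>u\<in>A. \<integral>t. g u t * (\<Prod>j\<in>u. K_anchored (x j) (t j)) \<partial>leb_prod D u) = 0"
    and u: "u \<in> A"
  shows "AE t in leb_prod D u. g u t = 0"
  using finite_active[OF u] u
proof (induction u rule: finite_psubset_induct)
  case (psubset u)
  note u = \<open>u \<in> A\<close> \<open>finite u\<close>
  show ?case
  proof (rule box_integrals_zero[OF u(2)])
    show "g u \<in> Lp u" using g u by (simp add: Lp_family_def)
    fix x assume x: "x \<in> PiE u (\<lambda>_. D)"
    define x' where "x' = (\<lambda>j\<in>{1..d}. if j \<in> u then x j else 0)"
    have x': "x' \<in> PiE {1..d} (\<lambda>_. D)"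
      using x zero_in_D by (auto simp: x'_def PiE_iff)
    have ud: "u \<subseteq> {1..d}" using u by (simp add: active_def)
    let ?I = "\<lambda>w. \<integral>t. g w t * (\<Prod>j\<in>w. K_anchored (x' j) (t j)) \<partial>leb_prod D w"
    have "?I w = 0" if w: "w \<in> A" "w \<noteq> u" for w
    proof (cases "w \<subseteq> u")
      case True
      \<comment> \<open>Here \<open>w\<close> is a proper subset of \<open>u\<close>, so the
        induction hypothesis applies.\<close>
      then have "AE t in leb_prod D w. g w t = 0"
        using w psubset.IH by auto
      then show ?thesis by (intro integral_eq_zero_AE) (auto elim: eventually_mono)
    next
      case False
      then obtain j where j: "j \<in> w" "j \<notin> u" by auto
      then have "x' j = 0" using w by (auto simp: x'_def active_def)
      then have "(\<Prod>j\<in>w. K_anchored (x' j) (t j)) = 0" for t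
        using j finite_active[OF w(1)] by (auto simp: K_anchored_def prod_zero_iff intro!: bexI[of _ j])
      then show ?thesis by simp
    qed
    then have "(\<Sum>w\<in>A. ?I w) = (\<Sum>w\<in>{u}. ?I w)"
      using u by (intro sum.mono_neutral_right) auto
    then have "?I u = 0" using z[OF x'] by simp
    moreover have "(\<Prod>j\<in>u. K_anchored (x' j) (t j)) = (\<Prod>j\<in>u. K_anchored (x j) (t j))" for t
      using ud by (intro prod.cong) (auto simp: x'_def)
    ultimately show "(\<integral>t. g u t * (\<Prod>j\<in>u. K_anchored (x j) (t j)) \<partial>leb_prod D u) = 0"
      by simp
  qed
qed

lemma T_anchored_classes_inj:
  assumes g: "Lp_family g" and h: "Lp_family h"
    and eq: "T\<^sub>0 (classes g) = T\<^sub>0 (classes h)"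
  shows "classes g = classes h"
proof -
  let ?f = "\<lambda>u t. g u t - h u t"
  have f: "Lp_family ?f"
    using g h unfolding Lp_family_def by (intro ballI Lp_fun_diff) blast+
  have "AE t in leb_prod D u. ?f u t = 0" if "u \<in> A" for u
  proof (rule anchored_sum_zero[OF f _ that])
    fix x assume x: "x \<in> PiE {1..d} (\<lambda>_. D)"
    have i: "integrable (leb_prod D w) (\<lambda>t. k w t * (\<Prod>j\<in>w. K_anchored (x j) (t j)))"
      if "w \<in> A" "Lp_family k" for k w
      using that x
      by (intro integrable_Lp_kernel admissible_anchored)
        (auto simp: Lp_family_def finite_active active_def)
    have "(\<Sum>u\<in>A. \<integral>t. ?f u t * (\<Prod>j\<in>u. K_anchored (x j) (t j)) \<partial>leb_prod D u)
        = (\<Sum>u\<in>A. \<integral>t. g u t * (\<Prod>j\<in>u. K_anchored (x j) (t j)) \<partial>leb_prod D u)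
        - (\<Sum>u\<in>A. \<integral>t. h u t * (\<Prod>j\<in>u. K_anchored (x j) (t j)) \<partial>leb_prod D u)"
      using i g h by (simp add: left_diff_distrib flip: sum_subtractf)
    also have "\<dots> = 0"
      using fun_cong[OF eq, of x] g h x by (simp add: T_sum_classes admissible_anchored)
    finally show "(\<Sum>u\<in>A. \<integral>t. ?f u t * (\<Prod>j\<in>u. K_anchored (x j) (t j)) \<partial>leb_prod D u) = 0" .
  qed
  then show ?thesis
    using g h finite_active by (simp add: classes_eq_iff AE_leb_psi_iff)
qed

text \<open>Independence of representatives is read off from the images: under
  \<open>T\<^sub>0\<close> both sides become \<open>T\<^sub>A\<close> of the same class, so null
  sets need not be followed through the marginals.\<close>

lemma J_minus_cong:
  assumes "Lp_family g" "Lp_family h" "classes g = classes h"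
  shows "classes (J (- 1) g) = classes (J (- 1) h)"
  using assms by (intro T_anchored_classes_inj) (auto simp: Lp_family_J T_anchored_J)

lemma J_plus_eq: "J 1 g = alternate (J (- 1) (alternate g))"
  by (simp add: J_alternate)

lemma J_plus_cong:
  assumes "Lp_family g" "Lp_family h" "classes g = classes h"
  shows "classes (J 1 g) = classes (J 1 h)"
  unfolding J_plus_eq using assms
  by (intro classes_alternate_cong J_minus_cong Lp_family_J Lp_family_alternate)

text \<open>Under \<open>T\<^sub>0\<close> the left side becomes
  \<open>T\<^sub>A (classes (J 1 g))\<close>, which is \<open>T\<^sub>0 (classes g)\<close>; no
  composition of marginals is computed.\<close>

lemma J_minus_plus:
  assumes "Lp_family g"
  shows "classes (J (- 1) (J 1 g)) = classes g"
  using assms by (intro T_anchored_classes_inj) (auto simp: Lp_family_J T_anchored_J T_anova_J)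

text \<open>The analogous argument through \<open>T\<^sub>A\<close> would be circular, since
  injectivity of \<open>T\<^sub>A\<close> is derived from this lemma. Conjugating
  \<open>J_minus_plus\<close> by the sign change gives the reverse order instead.\<close>

lemma J_plus_minus:
  assumes "Lp_family g"
  shows "classes (J 1 (J (- 1) g)) = classes g"
proof -
  have "J 1 (J (- 1) g) = alternate (J (- 1) (J 1 (alternate g)))"
    by (simp add: J_alternate)
  then show ?thesis
    using classes_alternate_cong[OF _ _ J_minus_plus[OF Lp_family_alternate[OF assms]]] assms
    by (simp add: Lp_family_J Lp_family_alternate)
qed

lemma inj_T_anchored: "inj_on T\<^sub>0 L"
  by (intro inj_onI) (metis ell_classes T_anchored_classes_inj)

text \<open>Equal ANOVA images have equal classes under \<open>J (- 1)\<close>, by anchored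
  injectivity, and \<open>J 1\<close> undoes \<open>J (- 1)\<close>.\<close>

lemma inj_T_anova: "inj_on T\<^sub>A L"
proof (rule inj_onI)
  fix G H assume "G \<in> L" "H \<in> L" and eq: "T\<^sub>A G = T\<^sub>A H"
  then obtain g h where gh: "Lp_family g" "G = classes g" "Lp_family h" "H = classes h"
    by (metis ell_classes)
  then have "classes (J (- 1) g) = classes (J (- 1) h)"
    using eq by (intro T_anchored_classes_inj) (auto simp: Lp_family_J T_anchored_J)
  from J_plus_cong[OF _ _ this] gh show "G = H"
    by (simp add: Lp_family_J J_plus_minus)
qed

text \<open>The involution as a map on the sequence space. It has to reach functions through
  \<open>rep\<close>; \<open>alternate_classes_classes\<close> shows that the choice is
  immaterial.\<close>

definition alternate_classes :: "family \<Rightarrow> family" where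
  "alternate_classes G = classes (alternate (\<lambda>u. rep (G u)))"

lemma alternate_classes_classes:
  assumes "Lp_family g"
  shows "alternate_classes (classes g) = classes (alternate g)"
proof -
  have G: "classes g u \<in> Lp_space (leb_psi D \<psi> u) p" if "u \<in> A" for u
    using assms classes_in_ell that by (auto simp: ell_def)
  have "Lp_family (\<lambda>u. rep (classes g u))"
    using Lp_space_rep(1)[OF G] by (simp add: Lp_family_def)
  moreover have "classes (\<lambda>u. rep (classes g u)) = classes g"
    using Lp_space_rep(2)[OF G] by (auto simp: classes_def fun_eq_iff restrict_def)
  ultimately show ?thesis
    unfolding alternate_classes_def using assms by (intro classes_alternate_cong)
qed

end

section \<open>The two embeddings\<close>

lemma op_norm_image:
  "op_norm (f ` L) N N' h = (SUP G \<in> {G \<in> L. N (f G) \<le> 1}. ennreal (N' (h (f G))))"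
proof -
  have "{v \<in> f ` L. N v \<le> 1} = f ` {G \<in> L. N (f G) \<le> 1}" by auto
  then show ?thesis by (simp add: op_norm_def image_image)
qed

text \<open>The norms on the function spaces are transported from \<open>L\<close>, so every
  supremum can be taken over the unit ball of \<open>L\<close>. There the inverse of
  \<open>j\<close> is S j S for a norm-preserving involution \<open>S\<close>, and S only permutes
  the ball and leaves the norms of the values alone.\<close>

lemma op_norm_conjugated_inverse:
  fixes L :: "'a set" and T\<^sub>A T\<^sub>0 :: "'a \<Rightarrow> 'b" and N :: "'a \<Rightarrow> real"
  defines "j \<equiv> \<lambda>G. inv_into L T\<^sub>0 (T\<^sub>A G)"
  assumes inj: "inj_on T\<^sub>0 L" "inj_on T\<^sub>A L" and ranges: "T\<^sub>A ` L = T\<^sub>0 ` L"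
    and S: "\<And>G. G \<in> L \<Longrightarrow> S G \<in> L" "\<And>G. G \<in> L \<Longrightarrow> S (S G) = G" "\<And>G. G \<in> L \<Longrightarrow> N (S G) = N G"
    and inverse: "\<And>G. G \<in> L \<Longrightarrow> T\<^sub>A (S (j (S G))) = T\<^sub>0 G"
  defines "N\<^sub>A \<equiv> \<lambda>f. N (inv_into L T\<^sub>A f)" and "N\<^sub>0 \<equiv> \<lambda>f. N (inv_into L T\<^sub>0 f)"
  defines "i \<equiv> restrict (\<lambda>f. f) (T\<^sub>A ` L)"
  shows "op_norm (T\<^sub>A ` L) N\<^sub>A N\<^sub>0 i = op_norm L N N (restrict j L)"
    and "op_norm (T\<^sub>0 ` L) N\<^sub>0 N\<^sub>A (inv_into (T\<^sub>A ` L) i) = op_norm L N N (restrict j L)"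
    and "op_norm L N N (inv_into L (restrict j L)) = op_norm L N N (restrict j L)"
proof -
  have jL: "j G \<in> L" "T\<^sub>0 (j G) = T\<^sub>A G" if "G \<in> L" for G
  proof -
    have "T\<^sub>A G \<in> T\<^sub>0 ` L" using that ranges by blast
    then show "j G \<in> L" "T\<^sub>0 (j G) = T\<^sub>A G"
      unfolding j_def by (rule inv_into_into, rule f_inv_into_f)
  qed
  have inv: "inv_into L T\<^sub>A (T\<^sub>A G) = G" "inv_into L T\<^sub>0 (T\<^sub>0 G) = G" if "G \<in> L" for G
    using that inj by auto
  have invA: "inv_into L T\<^sub>A (T\<^sub>0 G) = S (j (S G))" if "G \<in> L" for G
    using that inv(1)[of "S (j (S G))"] by (simp add: inverse S jL)
  have conj: "(SUP G \<in> {G \<in> L. N G \<le> 1}. ennreal (N (S (j (S G))))) = op_norm L N N (restrict j L)"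
  proof -
    \<comment> \<open>A norm-preserving involution maps the unit ball onto itself, so the supremum
      may be reindexed along \<open>S\<close>.\<close>
    have "{G \<in> L. N G \<le> 1} = S ` {G \<in> L. N G \<le> 1}"
      using S by (force intro: image_eqI[of _ S "S _"])
    then have "op_norm L N N (restrict j L) = (SUP G \<in> S ` {G \<in> L. N G \<le> 1}. ennreal (N (restrict j L G)))"
      by (simp add: op_norm_def)
    also have "\<dots> = (SUP G \<in> {G \<in> L. N G \<le> 1}. ennreal (N (S (j (S G)))))"
      unfolding image_image by (intro SUP_cong refl) (simp add: S jL)
    finally show ?thesis ..
  qed
  show "op_norm (T\<^sub>A ` L) N\<^sub>A N\<^sub>0 i = op_norm L N N (restrict j L)"
    unfolding op_norm_image by (simp add: op_norm_def N\<^sub>A_def N\<^sub>0_def i_def inv j_def cong: conj_cong SUP_cong_simp)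
  have "inj_on i (T\<^sub>A ` L)" by (auto simp: i_def inj_on_def)
  then have "inv_into (T\<^sub>A ` L) i f = f" if "f \<in> T\<^sub>A ` L" for f
    using that inv_into_f_f[of i "T\<^sub>A ` L" f] by (simp add: i_def)
  then have "inv_into (T\<^sub>A ` L) i (T\<^sub>0 G) = T\<^sub>0 G" if "G \<in> L" for G
    using that ranges by blast
  then show "op_norm (T\<^sub>0 ` L) N\<^sub>0 N\<^sub>A (inv_into (T\<^sub>A ` L) i) = op_norm L N N (restrict j L)"
    unfolding op_norm_image conj[symmetric]
    by (simp add: N\<^sub>A_def N\<^sub>0_def inv invA cong: conj_cong SUP_cong_simp)
  have "inj_on (restrict j L) L"
    using jL inj(2) by (auto simp: inj_on_def) metis
  \<comment> \<open>Together with injectivity of \<open>j\<close>, this right inverse identifies the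
    choice function \<open>inv_into L (restrict j L)\<close> on \<open>L\<close>.\<close>
  moreover have "j (S (j (S G))) = G" if "G \<in> L" for G
    using that by (simp add: j_def inverse[unfolded j_def] inv)
  ultimately have "inv_into L (restrict j L) G = S (j (S G))" if "G \<in> L" for G
    using that S jL inv_into_f_f[of "restrict j L" L "S (j (S G))"] by simp
  then show "op_norm L N N (inv_into L (restrict j L)) = op_norm L N N (restrict j L)"
    by (subst conj[symmetric], subst op_norm_def, intro SUP_cong) auto
qed

context weighted_family
begin

lemma ranges_eq: "T\<^sub>A ` L = T\<^sub>0 ` L"
proof (intro equalityI image_subsetI)
  fix G assume "G \<in> L"
  then obtain g where g: "Lp_family g" "G = classes g" by (rule ell_classes)
  show "T\<^sub>A G \<in> T\<^sub>0 ` L"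
    using T_anchored_J[OF g(1)] g Lp_family_J classes_in_ell by (metis imageI)
  show "T\<^sub>0 G \<in> T\<^sub>A ` L"
    using T_anova_J[OF g(1)] g Lp_family_J classes_in_ell by (metis imageI)
qed

lemma op_norms_equal:
  fixes q :: ennreal
  defines "W\<^sub>A \<equiv> W_space (K_anova D \<psi>) D \<psi> d \<gamma> p" and "W\<^sub>0 \<equiv> W_space K_anchored D \<psi> d \<gamma> p"
    and "N\<^sub>A \<equiv> W_norm (K_anova D \<psi>) D \<psi> d \<gamma> p q" and "N\<^sub>0 \<equiv> W_norm K_anchored D \<psi> d \<gamma> p q"
    and "N \<equiv> ell_norm D \<psi> d \<gamma> p q" and "i \<equiv> emb_i D \<psi> d \<gamma> p" and "j \<equiv> op_j D \<psi> d \<gamma> p"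
  shows "op_norm W\<^sub>A N\<^sub>A N\<^sub>0 i = op_norm L N N j"
    and "op_norm W\<^sub>0 N\<^sub>0 N\<^sub>A (inv_into W\<^sub>A i) = op_norm L N N j"
    and "op_norm L N N (inv_into L j) = op_norm L N N j"
proof -
  let ?j = "\<lambda>G. inv_into L T\<^sub>0 (T\<^sub>A G)"
  have j_classes: "?j (classes g) = classes (J (- 1) g)" if "Lp_family g" for g
    using that inv_into_f_f[OF inj_T_anchored classes_in_ell[OF Lp_family_J[OF that, of "- 1"]]]
    by (simp add: T_anchored_J)
  have S: "alternate_classes G \<in> L" "alternate_classes (alternate_classes G) = G" "N (alternate_classes G) = N G"
    "T\<^sub>A (alternate_classes (?j (alternate_classes G))) = T\<^sub>0 G" if G: "G \<in> L" for G
  proof -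
    obtain g where g: "Lp_family g" "G = classes g" using G by (rule ell_classes)
    then show "alternate_classes G \<in> L" "alternate_classes (alternate_classes G) = G" "N (alternate_classes G) = N G"
      by (simp_all add: alternate_classes_classes Lp_family_alternate classes_in_ell ell_norm_alternate N_def)
    show "T\<^sub>A (alternate_classes (?j (alternate_classes G))) = T\<^sub>0 G"
      \<comment> \<open>On representatives, conjugating \<open>J (- 1)\<close> by the sign change is
        \<open>J 1\<close>, so the left side is \<open>T\<^sub>A (classes (J 1 g))\<close>.\<close>
      using T_anova_J[OF g(1)] g
      by (simp add: alternate_classes_classes j_classes Lp_family_alternate Lp_family_J flip: J_plus_eq)
  qed
  have j: "j = restrict ?j L"
    by (auto simp: j_def op_j_def emb_i_def T_inv_def W_space_def fun_eq_iff restrict_def)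
  note * = op_norm_conjugated_inverse[where L = L and T\<^sub>A = "T\<^sub>A" and T\<^sub>0 = "T\<^sub>0"
      and S = alternate_classes and N = N, OF inj_T_anchored inj_T_anova ranges_eq S]
  have W: "W\<^sub>A = T\<^sub>A ` L" "W\<^sub>0 = T\<^sub>0 ` L" "i = restrict (\<lambda>f. f) (T\<^sub>A ` L)"
    by (simp_all add: W\<^sub>A_def W\<^sub>0_def i_def emb_i_def W_space_def)
  have NW: "N\<^sub>A = (\<lambda>f. N (inv_into L T\<^sub>A f))" "N\<^sub>0 = (\<lambda>f. N (inv_into L T\<^sub>0 f))"
    by (simp_all add: fun_eq_iff N\<^sub>A_def N\<^sub>0_def N_def W_norm_def T_inv_def)
  show "op_norm W\<^sub>A N\<^sub>A N\<^sub>0 i = op_norm L N N j"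
    unfolding W NW j by (rule *(1))
  show "op_norm W\<^sub>0 N\<^sub>0 N\<^sub>A (inv_into W\<^sub>A i) = op_norm L N N j"
    unfolding W NW j by (rule *(2))
  show "op_norm L N N (inv_into L j) = op_norm L N N j"
    unfolding j by (rule *(3))
qed

end

section \<open>Integrability condition\<close>

text \<open>The tail integral of a nonnegative function is decreasing, and monotone functions are
  Borel. The negation adapts it to \<open>borel_measurable_mono\<close>, which expects an increasing
  function.\<close>

lemma psi_bar_measurable:
  assumes D: "D \<in> sets borel" and int: "integrable (restrict_space lborel D) \<psi>"
    and nonneg: "\<And>x. x \<in> D \<Longrightarrow> 0 \<le> \<psi> x"
  shows "psi_bar D \<psi> \<in> borel_measurable borel"
proof -
  have i: "set_integrable lborel D \<psi>"
    using int D by (simp add: set_integrable_def integrable_restrict_space)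
  have "mono (\<lambda>t. - psi_bar D \<psi> t)"
  proof (rule monoI)
    fix s t :: real assume "s \<le> t"
    have "set_integrable lborel (D \<inter> {x..}) \<psi>" for x
      by (rule set_integrable_subset[OF i]) (use D in auto)
    then show "- psi_bar D \<psi> s \<le> - psi_bar D \<psi> t"
      unfolding psi_bar_def set_lebesgue_integral_def set_integrable_def
      using \<open>s \<le> t\<close> nonneg by (auto intro!: integral_mono simp: indicator_def)
  qed
  then have "(\<lambda>t. - (- psi_bar D \<psi> t)) \<in> borel_measurable borel"
    by (intro borel_measurable_uminus borel_measurable_mono)
  then show ?thesis by simp
qed

text \<open>Extension by zero carries the local part of the integrability condition, stated on [0,
  x), over to \<open>D\<close>, where it becomes the condition on the anchored kernel.\<close>

lemma Lp_fun_indicator_restrict: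
  assumes A: "A \<in> sets borel" "A \<subseteq> D" and D: "D \<in> sets borel"
    and g: "g \<in> borel_measurable (restrict_space lborel D)" "g \<in> Lp_fun (restrict_space lborel A) r"
  shows "(\<lambda>t. indicator A t * g t) \<in> Lp_fun (restrict_space lborel D) r"
proof -
  have [measurable]: "A \<in> sets (restrict_space lborel D)"
    using A D by (auto simp: sets_restrict_space_iff)
  note [measurable] = g(1)
  have m: "(\<lambda>t. indicator A t * g t) \<in> borel_measurable (restrict_space lborel D)"
    by measurable
  show ?thesis
  proof (cases "r = \<top>")
    case True
    from g(2) obtain B where B: "B \<ge> 0" "AE t in restrict_space lborel A. \<bar>g t\<bar> \<le> B"
      unfolding True Lp_fun_top_iff by auto
    then have "AE t in lborel. t \<in> A \<longrightarrow> \<bar>g t\<bar> \<le> B"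
      using A by (simp add: AE_restrict_space_iff)
    then have "AE t in lborel. t \<in> D \<longrightarrow> \<bar>indicator A t * g t\<bar> \<le> B"
      using B(1) by (auto elim!: eventually_mono simp: indicator_def)
    then have "AE t in restrict_space lborel D. \<bar>indicator A t * g t\<bar> \<le> B"
      using D by (simp add: AE_restrict_space_iff)
    with m B(1) show ?thesis unfolding True Lp_fun_top_iff by auto
  next
    case False
    have "integrable lborel (\<lambda>t. indicator A t *\<^sub>R \<bar>g t\<bar> powr enn2real r)"
      using g(2) A False by (simp add: Lp_fun_finite_iff integrable_restrict_space)
    \<comment> \<open>Outside \<open>A\<close> the base is 0, and \<open>0 powr r\<close> is 0 for
      every exponent.\<close>
    also have "(\<lambda>t. indicator A t *\<^sub>R \<bar>g t\<bar> powr enn2real r)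
        = (\<lambda>t. indicator D t *\<^sub>R \<bar>indicator A t * g t\<bar> powr enn2real r)"
      using A(2) by (auto simp: fun_eq_iff indicator_def)
    finally show ?thesis
      using m D False by (simp add: Lp_fun_finite_iff integrable_restrict_space)
  qed
qed

text \<open>For finite p the two halves of the condition give the two conclusions, the local half
  after extension by zero. For p infinite the weight is 1 almost everywhere: integrability of
  \<open>psi_bar\<close> is the condition itself, and the anchored kernel is the indicator of a
  bounded interval.\<close>

lemma integrability_condition_admissible:
  assumes D: "D \<in> sets borel" and Dx: "\<And>x. x \<in> D \<Longrightarrow> {0..<x} \<subseteq> D"
    and psi: "integrable (restrict_space lborel D) \<psi>"
    and nonneg: "\<And>x. x \<in> D \<Longrightarrow> 0 \<le> \<psi> x" and pos: "AE x in restrict_space lborel D. 0 < \<psi> x"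
    and cond: "integrability_condition D \<psi> p"
  shows "admissible D \<psi> p (psi_bar D \<psi>)"
    and "x \<in> D \<Longrightarrow> admissible D \<psi> p (K_anchored x)"
proof -
  let ?M = "restrict_space lborel D" and ?w = "\<lambda>t. \<psi> t powr (- 1 / enn2real p)"
  have [measurable]: "\<psi> \<in> borel_measurable ?M" using psi by auto
  have "psi_bar D \<psi> \<in> borel_measurable lborel"
    using psi_bar_measurable[OF D psi nonneg] by simp
  then have [measurable]: "psi_bar D \<psi> \<in> borel_measurable ?M"
    by (rule measurable_restrict_space1)
  have [measurable]: "K_anchored x \<in> borel_measurable ?M" for x
    unfolding K_anchored_def [abs_def] by (intro measurable_restrict_space1) auto
  have top: "admissible D \<psi> p \<phi>" if p: "p = \<top>" and \<phi>: "integrable ?M \<phi>" for \<phi>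
  proof -
    have [measurable]: "\<phi> \<in> borel_measurable ?M" using \<phi> by auto
    have e: "- 1 / enn2real p = 0" using p by simp
    have "(\<lambda>t. \<phi> t * ?w t) \<in> Lp_fun ?M 1"
    proof (rule Lp_fun_AE_cong)
      show "\<phi> \<in> Lp_fun ?M 1" using \<phi> by (simp add: Lp_fun_one_iff)
      show "AE t in ?M. \<phi> t = \<phi> t * ?w t"
        using pos unfolding e by eventually_elim simp
    qed measurable
    then show ?thesis using p by (simp add: admissible_def conjugate_index_def)
  qed
  show "admissible D \<psi> p (psi_bar D \<psi>)"
  proof (cases "p = \<top>")
    case True
    then have "integrable ?M (psi_bar D \<psi>)"
      using cond by (simp add: integrability_condition_def Lp_fun_one_iff)
    with True show ?thesis by (rule top)
  next
    case False
    then have "(\<lambda>t. psi_bar D \<psi> t * ?w t) \<in> Lp_fun ?M (conjugate_index p)"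
      using cond by (simp add: integrability_condition_def)
    then show ?thesis unfolding admissible_def by simp
  qed
  show "admissible D \<psi> p (K_anchored x)" if x: "x \<in> D"
  proof (cases "p = \<top>")
    case True
    have "integrable lborel (\<lambda>t. indicator D t *\<^sub>R K_anchored x t)"
    proof (rule Bochner_Integration.integrable_bound)
      show "integrable lborel (indicator {0..x} :: real \<Rightarrow> real)"
        by (intro integrable_real_indicator) (simp_all add: emeasure_lborel_Icc_eq)
    qed (use D in \<open>auto simp: K_anchored_def indicator_def\<close>)
    then have "integrable ?M (K_anchored x)"
      using D by (simp add: integrable_restrict_space)
    then show ?thesis using top True by blast
  next
    case False
    then have "?w \<in> Lp_fun (restrict_space lborel {0..<x}) (conjugate_index p)"
      using cond x by (auto simp: integrability_condition_def Lp_loc_def)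
    then have "(\<lambda>t. indicator {0..<x} t * ?w t) \<in> Lp_fun ?M (conjugate_index p)"
      using D Dx[OF x] by (intro Lp_fun_indicator_restrict[where A = "{0..<x}"]) simp_all
    then show ?thesis
      by (simp add: admissible_def) (simp add: K_anchored_def)
  qed
qed

theorem proposition14:
  fixes T :: ereal and D :: "real set" and \<psi> :: "real \<Rightarrow> real"
    and d :: nat and \<gamma> :: "nat set \<Rightarrow> real" and p q :: ennreal
  assumes "0 < T"
    and "D = {x. 0 \<le> x \<and> ereal x < T} \<or> T < \<infinity> \<and> D = {x. 0 \<le> x \<and> ereal x \<le> T}"
    and "\<psi> \<in> borel_measurable (restrict_space lborel D)"
    and "\<forall>x\<in>D. 0 \<le> \<psi> x"
    and "prob_space (density (restrict_space lborel D) (\<lambda>x. ennreal (\<psi> x)))"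
    and "AE x in restrict_space lborel D. 0 < \<psi> x"
    and "1 \<le> d" and "1 \<le> p" and "1 \<le> q"
    and "integrability_condition D \<psi> p"
    and "\<forall>u\<subseteq>{1..d}. 0 \<le> \<gamma> u"
    and "\<exists>u\<subseteq>{1..d}. \<gamma> u \<noteq> 0"
    and "\<forall>w\<subseteq>{1..d}. 0 < \<gamma> w \<longrightarrow> (\<forall>u\<subseteq>w. 0 < \<gamma> u)"
  defines "W\<^sub>A \<equiv> W_space (K_anova D \<psi>) D \<psi> d \<gamma> p"
    and "W\<^sub>0 \<equiv> W_space K_anchored D \<psi> d \<gamma> p"
    and "N\<^sub>A \<equiv> W_norm (K_anova D \<psi>) D \<psi> d \<gamma> p q"
    and "N\<^sub>0 \<equiv> W_norm K_anchored D \<psi> d \<gamma> p q"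
    and "L \<equiv> ell D \<psi> d \<gamma> p"
    and "N \<equiv> ell_norm D \<psi> d \<gamma> p q"
    and "i \<equiv> emb_i D \<psi> d \<gamma> p"
    and "j \<equiv> op_j D \<psi> d \<gamma> p"
  shows "op_norm W\<^sub>A N\<^sub>A N\<^sub>0 i = op_norm W\<^sub>0 N\<^sub>0 N\<^sub>A (inv_into W\<^sub>A i) \<and>
    op_norm W\<^sub>0 N\<^sub>0 N\<^sub>A (inv_into W\<^sub>A i) = op_norm L N N j \<and>
    op_norm L N N j = op_norm L N N (inv_into L j)"
proof -
  let ?M = "restrict_space lborel D"
  have D_iff: "x \<in> D \<longleftrightarrow> 0 \<le> x \<and> ereal x < T" if "ereal x \<noteq> T" for x
    using assms(2) that by (auto simp: less_le)
  have D_le: "0 \<le> x" "ereal x \<le> T" if "x \<in> D" for x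
    using assms(2) that by auto
  have "{x. 0 \<le> x \<and> ereal x < T} \<in> sets borel" "{x. 0 \<le> x \<and> ereal x \<le> T} \<in> sets borel"
    by measurable
  then have D: "D \<in> sets borel" using assms(2) by auto
  have nonneg: "0 \<le> \<psi> x" if "x \<in> D" for x using assms(4) that by blast
  have down: "y \<in> D" if "x \<in> D" "0 \<le> y" "y \<le> x" for x y
    using assms(2) that by (auto intro: le_less_trans[of "ereal y" "ereal x"] order_trans[of "ereal y" "ereal x"])
  have "emeasure (density ?M (\<lambda>x. ennreal (\<psi> x))) D = 1"
    using prob_space.emeasure_space_1[OF assms(5)] by (simp add: space_restrict_space)
  moreover have "D \<in> sets ?M" using D by (auto simp: sets_restrict_space_iff)
  ultimately have "(\<integral>\<^sup>+x. ennreal (\<psi> x) * indicator D x \<partial>?M) = 1"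
    using assms(3) by (simp add: emeasure_density)
  also have "(\<integral>\<^sup>+x. ennreal (\<psi> x) * indicator D x \<partial>?M) = (\<integral>\<^sup>+x. ennreal (\<psi> x) \<partial>?M)"
    by (intro nn_integral_cong) (auto simp: space_restrict_space)
  finally have int: "integrable ?M \<psi>"
    using assms(3) nonneg by (intro integrableI_nonneg) (auto intro!: AE_I2 simp: space_restrict_space)
  \<comment> \<open>A finite right endpoint is discarded as a null set. For infinite
    \<open>T\<close> the default value of \<open>real_of_ereal\<close> is 0, and discarding that
    point is harmless.\<close>
  have "AE x in lborel. x \<in> D \<longrightarrow> (\<exists>y\<in>D \<inter> \<rat>. x < y)"
    using AE_lborel_singleton[of "real_of_ereal T"]
  proof eventually_elim
    case (elim x)
    show ?case
    proof
      assume x: "x \<in> D"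
      then have "ereal x < T" using D_le[OF x] elim by (cases T) auto
      then obtain z where z: "x < z" "ereal z < T"
        using ereal_dense2[of "ereal x" T] by auto
      obtain y where "y \<in> \<rat>" "x < y" "y < z" using Rats_dense_in_real[OF z(1)] by blast
      moreover from this have "ereal y < ereal z" by simp
      then have "ereal y < T" using z(2) by (rule less_trans)
      then have "y \<in> D" using D_iff[of y] D_le(1)[OF x] \<open>x < y\<close> by auto
      ultimately show "\<exists>y\<in>D \<inter> \<rat>. x < y" by blast
    qed
  qed
  then have exhausted: "AE x in ?M. \<exists>y\<in>D \<inter> \<rat>. x < y"
    using D by (simp add: AE_restrict_space_iff)
  have sub: "{0..<x} \<subseteq> D" if "x \<in> D" for x using down[OF that] by auto
  have admissible: "admissible D \<psi> p (psi_bar D \<psi>)"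
    "\<And>x. x \<in> D \<Longrightarrow> admissible D \<psi> p (K_anchored x)"
    by (rule integrability_condition_admissible[OF D sub int nonneg assms(6,10)]; assumption)+
  interpret weighted_family D \<psi> p d \<gamma>
  proof
    show "0 \<in> D" using assms(1) D_iff[of 0] by (simp add: zero_ereal_def[symmetric])
    show "u \<in> active d \<gamma>" if "w \<in> active d \<gamma>" "u \<subseteq> w" for u w
      using that assms(13) by (auto simp: active_def)
  qed (fact D assms(3,6,8) nonneg D_le(1) down exhausted admissible)+
  show ?thesis
    unfolding W\<^sub>A_def W\<^sub>0_def N\<^sub>A_def N\<^sub>0_def L_def N_def i_def j_def by (simp add: op_norms_equal)
qed

end
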